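(* Let $m,n\in\mathbb{N}_0$, let $\alpha,\beta>-1$ be such that if $\alpha,\beta\in(-1,0)$ then $\alpha+\beta+1\neq0$, and let $\rho\in\{z\in\mathbb{C}:0<|z|<1\}\setminus(-1,0]$. With $R=\sqrt{1+\rho^2-2\rho x}$ and $\zeta_+=(1+\rho)/R$, $$\int_{-1}^1\frac{(1-x)^\alpha(1+x)^{\beta/2}}{R^{\alpha+m+1}}\,P_{\alpha+m}^{-\beta}(\zeta_+)\,P_n^{(\alpha,\beta)}(x)\,dx=\frac{2^{\alpha+\beta/2+1}\,\Gamma(\alpha+n+1)\,(\alpha+\beta+m+1)_{2n}}{n!\,\rho^{(\alpha+1)/2}(1-\rho)^m}\,P_{-m}^{-\alpha-\beta-2n-1}\!\left(\frac{1+\rho}{1-\rho}\right).$$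
   Context: $\mathbb{N}_0=\{0,1,2,\dots\}$. $(z)_n=\prod_{i=1}^n(z+i-1)$ is the Pochhammer symbol. ${}_2F_1$ is the Gauss hypergeometric function, analytically continued to $\mathbb{C}\setminus[1,\infty)$. The Jacobi polynomials are $P_n^{(\alpha,\beta)}(z)=\frac{(\alpha+1)_n}{n!}\,{}_2F_1(-n,n+\alpha+\beta+1;\alpha+1;\frac{1-z}{2})$. The associated Legendre function of the first kind on $\mathbb{C}\setminus(-\infty,1]$ is $P_\nu^\mu(z)=\frac{1}{\Gamma(1-\mu)}\left(\frac{z+1}{z-1}\right)^{\mu/2}{}_2F_1(-\nu,\nu+1;1-\mu;\frac{1-z}{2})$. All powers and square roots are principal. *)

theory Defs
  imports "HOL-Complex_Analysis.Complex_Analysis"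
begin

text \<open>
  Throughout, \<open>powr\<close>, \<open>Ln\<close> and \<open>csqrt\<close> on complex arguments are the principal branches.
\<close>

definition hyp2F1_series :: "complex \<Rightarrow> complex \<Rightarrow> complex \<Rightarrow> complex \<Rightarrow> complex" where
  "hyp2F1_series a b c z =
     (\<Sum>k. pochhammer a k * pochhammer b k / (pochhammer c k * fact k) * z ^ k)"

definition hyp2F1_domain :: "complex set" where
  "hyp2F1_domain = - (of_real ` {1::real..})"

definition is_hyp2F1_continuation ::
    "complex \<Rightarrow> complex \<Rightarrow> complex \<Rightarrow> (complex \<Rightarrow> complex) \<Rightarrow> bool" where
  "is_hyp2F1_continuation a b c f \<longleftrightarrow>
     f holomorphic_on hyp2F1_domain \<and> (\<forall>z\<in>ball 0 1. f z = hyp2F1_series a b c z)"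

text \<open>
  The domain is connected, so the continuation is determined on it by the series; the
  values on the cut are arbitrary. If \<open>a\<close> or \<open>b\<close> is a nonpositive integer then the series
  is a polynomial in \<open>z\<close>, which is used on the whole plane, cut included. The parameter
  \<open>c\<close> is meant to avoid the nonpositive integers.
\<close>

definition hyp2F1 :: "complex \<Rightarrow> complex \<Rightarrow> complex \<Rightarrow> complex \<Rightarrow> complex" where
  "hyp2F1 a b c z =
     (if a \<in> \<int>\<^sub>\<le>\<^sub>0 \<or> b \<in> \<int>\<^sub>\<le>\<^sub>0 then hyp2F1_series a b c z
      else (SOME f. is_hyp2F1_continuation a b c f) z)"

definition jacobi_P :: "nat \<Rightarrow> complex \<Rightarrow> complex \<Rightarrow> complex \<Rightarrow> complex" where
  "jacobi_P n \<alpha> \<beta> z =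
     pochhammer (\<alpha> + 1) n / fact n
     * hyp2F1 (- of_nat n) (of_nat n + \<alpha> + \<beta> + 1) (\<alpha> + 1) ((1 - z) / 2)"

text \<open>
  Associated Legendre function of the first kind of degree \<open>\<nu>\<close> and order \<open>\<mu>\<close>, for
  \<open>z\<close> outside the cut \<open>(-\<infinity>, 1]\<close> and \<open>\<mu>\<close> not a positive integer.
\<close>

definition legendre_P :: "complex \<Rightarrow> complex \<Rightarrow> complex \<Rightarrow> complex" where
  "legendre_P \<nu> \<mu> z =
     1 / Gamma (1 - \<mu>) * ((z + 1) / (z - 1)) powr (\<mu> / 2)
     * hyp2F1 (- \<nu>) (\<nu> + 1) (1 - \<mu>) ((1 - z) / 2)"

end

theory Submission
  imports Defs
begin

text \<open>
  Put \<open>t = (1 + x) / 2\<close>, \<open>v = 4 \<rho> / (1 + \<rho>)\<^sup>2\<close>, \<open>\<gamma> = \<alpha> + m\<close> and \<open>A = \<gamma> + \<beta> + 1\<close>. Since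
  \<open>R\<^sup>2 = (1 + \<rho>)\<^sup>2 (1 - v t)\<close>, the argument \<open>\<zeta> = (1 + \<rho>) / R\<close> of the Legendre function satisfies
  \<open>1 - \<zeta>\<^sup>-\<^sup>2 = v t\<close>. The quadratic transformation

    \<open>F(-\<gamma>, \<gamma> + 1; \<beta> + 1; (1 - \<zeta>) / 2)
        = ((1 + \<zeta>) / 2) powr \<beta> * \<zeta> powr (-A) * F(A / 2, (A + 1) / 2; \<beta> + 1; 1 - \<zeta>\<^sup>-\<^sup>2)\<close>

  (\<open>quadratic_transformation\<close>, valid for \<open>Re \<zeta> > 0\<close>) therefore turns the Legendre function, divided by
  the power of \<open>R\<close>, into an elementary factor times \<open>\<Phi>(v t)\<close>, where \<open>\<Phi>\<close> is a fixed hypergeometric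
  function and all the powers collapse to \<open>\<rho> powr (\<beta> / 2) * t powr (\<beta> / 2) * (1 + \<rho>) powr (-A)\<close>
  (\<open>legendre_P_left\<close>). What remains is the integral over \<open>[0, 1]\<close> of a Jacobi weight times a Jacobi
  polynomial times \<open>\<Phi>(v t)\<close>.

  For \<open>|v| < 1\<close> this integral can be computed term by term. By the Chu--Vandermonde sum the \<open>k\<close>-th
  moment of weight times polynomial is \<open>(k choose n) Beta(\<beta> + 1 + k, \<alpha> + 1 + n)\<close>; the first \<open>n\<close> moments
  vanish (orthogonality) and the rest shift the parameters of \<open>\<Phi>\<close> by \<open>n\<close>, giving a constant times
  \<open>v ^ n * F(A / 2 + n, (A + 1) / 2 + n; \<alpha> + \<beta> + 2 n + 2; v)\<close>. Both sides are holomorphic in \<open>v\<close> on the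
  plane cut along \<open>[1, \<infinity>)\<close>, so the formula persists there (\<open>jacobi_transform\<close>), and \<open>\<rho> \<mapsto> v\<close> maps the unit
  disc into the cut plane. Finally the same quadratic transformation, read backwards at
  \<open>\<zeta> = (1 + \<rho>) / (1 - \<rho>)\<close>, where \<open>1 - \<zeta>\<^sup>-\<^sup>2 = v\<close>, recognises the result as the Legendre function on the
  right-hand side (\<open>legendre_P_right\<close>).

  Two points need care. The continuation of the hypergeometric series to the cut plane must be shown
  to exist: Euler's integral provides it for \<open>c > b > 0\<close>, and a first-order operator lowers \<open>c\<close>
  (\<open>ex_hyp2F1_continuation\<close>). And the principal branches must fit together: the logarithmic identity
  behind the collapse of the powers holds modulo \<open>2 \<pi> \<i>\<close> for trivial reasons, is continuous in \<open>t\<close>, and is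
  exact at \<open>t = 1\<close> (\<open>Ln_branch_identity\<close>).
\<close>

section \<open>The cut plane and moment transforms\<close>

lemma hyp2F1_domain_iff: "z \<in> hyp2F1_domain \<longleftrightarrow> \<not> (Im z = 0 \<and> Re z \<ge> 1)"
  unfolding hyp2F1_domain_def by (auto simp: complex_eq_iff image_iff intro!: bexI[of _ "Re z"])

lemma open_hyp2F1_domain [simp]: "open hyp2F1_domain"
proof -
  have "hyp2F1_domain = {z. Im z \<noteq> 0} \<union> {z. Re z < 1}"
    by (auto simp: hyp2F1_domain_iff)
  moreover have "open {z. Im z \<noteq> 0}"
    by (intro open_Collect_neq continuous_intros)
  moreover have "open {z. Re z < 1}"
    by (intro open_Collect_less continuous_intros)
  ultimately show ?thesis by (metis open_Un)
qed

lemma zero_in_hyp2F1_domain [simp]: "0 \<in> hyp2F1_domain"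
  by (simp add: hyp2F1_domain_iff)

lemma ball_subset_hyp2F1_domain: "ball 0 1 \<subseteq> hyp2F1_domain"
proof
  fix z :: complex assume "z \<in> ball 0 1"
  then show "z \<in> hyp2F1_domain" using complex_Re_le_cmod[of z] by (auto simp: hyp2F1_domain_iff)
qed

lemma hyp2F1_domain_scale:
  assumes "v \<in> hyp2F1_domain" "0 \<le> t" "t \<le> 1"
  shows "v * of_real t \<in> hyp2F1_domain"
proof (rule ccontr)
  assume "v * of_real t \<notin> hyp2F1_domain"
  then have *: "Im v * t = 0" "Re v * t \<ge> 1" by (auto simp: hyp2F1_domain_iff)
  then have "t \<noteq> 0" by auto
  with * have "Im v = 0" by simp
  moreover have "Re v \<ge> 1"
  proof (rule ccontr)
    assume "\<not> Re v \<ge> 1"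
    then have "Re v * t < 1 * t"
      using assms \<open>t \<noteq> 0\<close> by (intro mult_strict_right_mono) auto
    with * assms show False by simp
  qed
  ultimately show False using assms by (simp add: hyp2F1_domain_iff)
qed

lemma connected_hyp2F1_domain [simp]: "connected hyp2F1_domain"
proof (rule starlike_imp_connected)
  show "starlike hyp2F1_domain"
    unfolding starlike_def
  proof (intro bexI[of _ 0] ballI subsetI)
    fix v z assume "v \<in> hyp2F1_domain" "z \<in> closed_segment 0 v"
    then show "z \<in> hyp2F1_domain"
      using hyp2F1_domain_scale[of v] by (auto simp: in_segment scaleR_conv_of_real mult.commute)
  qed simp
qed

lemma absolutely_integrable_mult_continuous:
  fixes q g :: "real \<Rightarrow> complex"
  assumes "q absolutely_integrable_on {0..1}" "continuous_on {0..1} g"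
  shows "(\<lambda>t. q t * g t) absolutely_integrable_on {0..1}"
proof -
  have "(\<lambda>t. g t * q t) absolutely_integrable_on {0..1}"
  proof (rule absolutely_integrable_bounded_measurable_product[where h = "(*)"])
    show "bilinear ((*) :: complex \<Rightarrow> _)" by (rule bilinear_times)
    show "g \<in> borel_measurable (lebesgue_on {0..1})"
      using assms by (intro continuous_imp_measurable_on_sets_lebesgue) auto
    show "bounded (g ` {0..1})"
      using assms by (intro compact_imp_bounded compact_continuous_image) auto
  qed (use assms in auto)
  then show ?thesis by (simp add: mult.commute)
qed

text \<open>
  Integrating \<open>\<Phi>(v t)\<close> against a weight in \<open>t\<close> multiplies the Taylor coefficients of \<open>\<Phi>\<close> by the moments
  of the weight, and preserves holomorphy on the cut plane because that domain is starlike about \<open>0\<close>.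
  This is used twice: with a beta weight it is Euler's integral, which constructs the hypergeometric
  function on the cut plane; with a Jacobi weight it evaluates the integral of the theorem. The weights
  may be unbounded at the endpoints, so only integrability is assumed of them, and the interchange of
  limits rests on dominated convergence.
\<close>

context
  fixes q :: "real \<Rightarrow> complex" and \<Phi> :: "complex \<Rightarrow> complex"
  assumes q: "q absolutely_integrable_on {0..1}"
    and hol: "\<Phi> holomorphic_on hyp2F1_domain"
begin

lemma moment_transform_integrable:
  assumes "v \<in> hyp2F1_domain"
  shows "(\<lambda>t. q t * \<Phi> (v * of_real t)) absolutely_integrable_on {0..1}"
proof (rule absolutely_integrable_mult_continuous[OF q])
  show "continuous_on {0..1} (\<lambda>t. \<Phi> (v * complex_of_real t))"
    using assms hyp2F1_domain_scale
    by (intro continuous_on_compose2[OF holomorphic_on_imp_continuous_on[OF hol]] continuous_intros)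
       auto
qed

lemma moment_transform_holomorphic:
  "(\<lambda>v. integral {0..1} (\<lambda>t. q t * \<Phi> (v * of_real t))) holomorphic_on hyp2F1_domain"
proof -
  define V where "V = (\<lambda>v. integral {0..1} (\<lambda>t. q t * \<Phi> (v * of_real t)))"
  have int: "(\<lambda>t. q t * \<Phi> (v * of_real t)) integrable_on {0..1}" if "v \<in> hyp2F1_domain" for v
    using moment_transform_integrable[OF that] by (simp add: absolutely_integrable_on_def)
  have "V field_differentiable at v0" if v0: "v0 \<in> hyp2F1_domain" for v0
  proof -
    obtain r where r: "r > 0" "cball v0 r \<subseteq> hyp2F1_domain"
      using open_contains_cball open_hyp2F1_domain v0 by blast
    define K where "K = (\<lambda>(v, t). v * complex_of_real t) ` (cball v0 r \<times> {0..1})"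
    have K: "compact K" unfolding K_def
      by (intro compact_continuous_image continuous_intros compact_Times)
         (auto intro!: continuous_intros simp: split_def)
    have Ksub: "K \<subseteq> hyp2F1_domain" unfolding K_def using r hyp2F1_domain_scale by auto
    have hold: "deriv \<Phi> holomorphic_on hyp2F1_domain"
      by (intro holomorphic_deriv hol) auto
    have "bounded (deriv \<Phi> ` K)"
      using K Ksub hold
      by (intro compact_imp_bounded compact_continuous_image)
         (auto intro: holomorphic_on_imp_continuous_on holomorphic_on_subset)
    then obtain M where M: "\<And>z. z \<in> K \<Longrightarrow> norm (deriv \<Phi> z) \<le> M"
      by (auto simp: bounded_iff)
    have lip: "norm (\<Phi> (w * of_real t) - \<Phi> (v0 * of_real t)) \<le> M * norm (w - v0)"
      if "w \<in> cball v0 r" "t \<in> {0..1}" for w t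
    proof -
      have "norm (\<Phi> (w * of_real t) - \<Phi> (v0 * of_real t)) \<le> M * norm (w - v0)"
      proof (rule field_differentiable_bound[where S = "cball v0 r"
              and f = "\<lambda>w. \<Phi> (w * of_real t)" and f' = "\<lambda>w. deriv \<Phi> (w * of_real t) * of_real t"])
        fix z assume z: "z \<in> cball v0 r"
        then have zt: "z * of_real t \<in> K" unfolding K_def using that by force
        then have "(\<Phi> has_field_derivative deriv \<Phi> (z * of_real t)) (at (z * of_real t))"
          using Ksub by (intro holomorphic_derivI[OF hol]) auto
        then show "((\<lambda>w. \<Phi> (w * of_real t)) has_field_derivative
                      deriv \<Phi> (z * of_real t) * of_real t) (at z within cball v0 r)"
          by (rule DERIV_chain2[OF _ has_field_derivative_at_within])
             (auto intro!: derivative_eq_intros)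
        have "norm (deriv \<Phi> (z * of_real t)) * \<bar>t\<bar> \<le> M * 1"
          using M[OF zt] that by (intro mult_mono) (auto intro: order_trans[OF norm_ge_zero])
        then show "norm (deriv \<Phi> (z * of_real t) * of_real t) \<le> M"
          by (simp add: norm_mult)
      qed (use that r in auto)
      then show ?thesis .
    qed
    define D where "D = integral {0..1} (\<lambda>t. q t * (deriv \<Phi> (v0 * of_real t) * of_real t))"
    have "((\<lambda>w. (V w - V v0) / (w - v0)) \<longlongrightarrow> D) (at v0 within cball v0 r)"
      unfolding tendsto_at_iff_sequentially
    proof (intro allI impI)
      fix X assume X: "\<forall>i. X i \<in> cball v0 r - {v0}" "X \<longlonglongrightarrow> v0"
      define f where "f = (\<lambda>i t. q t * ((\<Phi> (X i * of_real t) - \<Phi> (v0 * of_real t)) / (X i - v0)))"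
      have Xd: "X i \<in> hyp2F1_domain" for i using X r by auto
      have f: "(f i has_integral (V (X i) - V v0) / (X i - v0)) {0..1}" for i
      proof -
        have "((\<lambda>t. (q t * \<Phi> (X i * of_real t) - q t * \<Phi> (v0 * of_real t)) / (X i - v0))
               has_integral (V (X i) - V v0) / (X i - v0)) {0..1}"
          unfolding V_def using int[OF Xd[of i]] int[OF v0]
          by (intro has_integral_divide has_integral_diff integrable_integral)
        then show ?thesis by (simp add: f_def algebra_simps diff_divide_distrib)
      qed
      have "(\<lambda>i. integral {0..1} (f i)) \<longlonglongrightarrow> D"
        unfolding D_def
      proof (rule dominated_convergence)
        show "f i integrable_on {0..1}" for i using f by (rule has_integral_integrable)
        show "(\<lambda>t. norm (q t) * M) integrable_on {0..1}"
          using q by (intro integrable_on_mult_left) (auto simp: absolutely_integrable_on_def)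
        show "norm (f i t) \<le> norm (q t) * M" if "t \<in> {0..1}" for i t
        proof -
          have "X i \<noteq> v0" "X i \<in> cball v0 r" using X by auto
          then show ?thesis
            using lip[OF _ that, of "X i"]
            unfolding f_def norm_mult norm_divide
            by (intro mult_left_mono) (auto simp: field_simps)
        qed
        show "(\<lambda>i. f i t) \<longlonglongrightarrow> q t * (deriv \<Phi> (v0 * of_real t) * of_real t)"
          if t: "t \<in> {0..1}" for t
        proof -
          have "(\<Phi> has_field_derivative deriv \<Phi> (v0 * of_real t)) (at (v0 * of_real t))"
            using v0 t by (intro holomorphic_derivI[OF hol]) (auto intro: hyp2F1_domain_scale)
          then have "((\<lambda>w. \<Phi> (w * of_real t)) has_field_derivative
                      deriv \<Phi> (v0 * of_real t) * of_real t) (at v0 within cball v0 r)"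
            by (rule DERIV_chain2[OF _ has_field_derivative_at_within])
               (auto intro!: derivative_eq_intros)
          then have "((\<lambda>w. (\<Phi> (w * of_real t) - \<Phi> (v0 * of_real t)) / (w - v0)) \<longlongrightarrow>
                       deriv \<Phi> (v0 * of_real t) * of_real t) (at v0 within cball v0 r)"
            by (simp add: has_field_derivative_iff)
          then have "(\<lambda>i. (\<Phi> (X i * of_real t) - \<Phi> (v0 * of_real t)) / (X i - v0)) \<longlonglongrightarrow>
                       deriv \<Phi> (v0 * of_real t) * of_real t"
            using X unfolding tendsto_at_iff_sequentially by (auto simp: o_def)
          then show ?thesis unfolding f_def by (intro tendsto_intros)
        qed
      qed
      then show "((\<lambda>w. (V w - V v0) / (w - v0)) \<circ> X) \<longlonglongrightarrow> D"
        using f by (simp add: o_def integral_unique[OF f])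
    qed
    then have "(V has_field_derivative D) (at v0 within cball v0 r)"
      by (simp add: has_field_derivative_iff)
    moreover have "at v0 within cball v0 r = at v0"
      using r by (intro at_within_interior) (simp add: interior_cball)
    ultimately show ?thesis
      unfolding field_differentiable_def by metis
  qed
  then show ?thesis
    unfolding V_def[symmetric] holomorphic_on_def by (blast intro: field_differentiable_at_within)
qed

lemma moment_transform_sums:
  assumes series: "\<And>z. norm z < 1 \<Longrightarrow> (\<lambda>k. \<phi> k * z ^ k) sums \<Phi> z"
    and v: "norm v < 1"
  shows "(\<lambda>k. \<phi> k * integral {0..1} (\<lambda>t. q t * of_real t ^ k) * v ^ k) sums
           integral {0..1} (\<lambda>t. q t * \<Phi> (v * of_real t))"
proof -
  define f where "f = (\<lambda>N t. q t * (\<Sum>k<N. \<phi> k * (v * of_real t) ^ k))"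
  have intk: "(\<lambda>t. q t * of_real t ^ k) integrable_on {0..1}" for k
  proof -
    have "continuous_on {0..1} (\<lambda>t. complex_of_real t ^ k)" by (intro continuous_intros)
    from absolutely_integrable_mult_continuous[OF q this] show ?thesis
      by (simp add: absolutely_integrable_on_def)
  qed
  have f: "(f N has_integral (\<Sum>k<N. \<phi> k * integral {0..1} (\<lambda>t. q t * of_real t ^ k) * v ^ k)) {0..1}" for N
  proof -
    have "((\<lambda>t. \<Sum>k<N. \<phi> k * (q t * of_real t ^ k) * v ^ k) has_integral
            (\<Sum>k<N. \<phi> k * integral {0..1} (\<lambda>t. q t * of_real t ^ k) * v ^ k)) {0..1}"
      by (intro has_integral_sum has_integral_mult_left has_integral_mult_right
            integrable_integral intk) auto
    then show ?thesis
      by (simp add: f_def sum_distrib_left power_mult_distrib mult_ac)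
  qed
  obtain r where r: "norm v < r" "r < 1" using v dense by blast
  have "summable (\<lambda>k. norm (\<phi> k * v ^ k))"
  proof (rule powser_insidea)
    show "summable (\<lambda>k. \<phi> k * of_real r ^ k)"
      using series[of "of_real r"] r norm_ge_zero[of v] by (auto simp: sums_iff simp del: norm_ge_zero)
    show "norm v < norm (of_real r :: complex)" using r by simp
  qed
  then have sumv: "summable (\<lambda>k. norm (\<phi> k) * norm v ^ k)" by (simp add: norm_mult norm_power)
  define S where "S = (\<Sum>k. norm (\<phi> k) * norm v ^ k)"
  have "(\<lambda>N. integral {0..1} (f N)) \<longlonglongrightarrow> integral {0..1} (\<lambda>t. q t * \<Phi> (v * of_real t))"
  proof (rule dominated_convergence)
    show "f N integrable_on {0..1}" for N using f by (rule has_integral_integrable)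
    show "(\<lambda>t. norm (q t) * S) integrable_on {0..1}"
      using q by (intro integrable_on_mult_left) (auto simp: absolutely_integrable_on_def)
    show "norm (f N t) \<le> norm (q t) * S" if t: "t \<in> {0..1}" for N t
    proof -
      have "norm (\<Sum>k<N. \<phi> k * (v * of_real t) ^ k) \<le> (\<Sum>k<N. norm (\<phi> k) * norm v ^ k)"
      proof (rule sum_norm_le)
        fix k
        have "(norm v * t) ^ k \<le> (norm v * 1) ^ k"
          using t by (intro power_mono mult_left_mono) auto
        then show "norm (\<phi> k * (v * of_real t) ^ k) \<le> norm (\<phi> k) * norm v ^ k"
          using t by (auto simp: norm_mult norm_power intro!: mult_left_mono)
      qed
      also have "\<dots> \<le> S" unfolding S_def
        by (intro sum_le_suminf sumv) auto
      finally show ?thesis unfolding f_def norm_mult by (intro mult_left_mono) auto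
    qed
    show "(\<lambda>N. f N t) \<longlonglongrightarrow> q t * \<Phi> (v * of_real t)" if t: "t \<in> {0..1}" for t
    proof -
      have "norm v * t \<le> norm v * 1" using t by (intro mult_left_mono) auto
      then have "norm (v * of_real t) < 1" using v t by (simp add: norm_mult)
      from series[OF this] show ?thesis
        unfolding f_def sums_def by (intro tendsto_intros)
    qed
  qed
  then show ?thesis
    unfolding sums_def by (simp add: integral_unique[OF f])
qed

end

section \<open>Analytic continuation of the hypergeometric series\<close>

definition hyp2F1_coeff :: "complex \<Rightarrow> complex \<Rightarrow> complex \<Rightarrow> nat \<Rightarrow> complex" where
  "hyp2F1_coeff a b c k = pochhammer a k * pochhammer b k / (pochhammer c k * fact k)"

lemma hyp2F1_coeff_0 [simp]: "hyp2F1_coeff a b c 0 = 1"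
  by (simp add: hyp2F1_coeff_def)

lemma nonpos_Ints_plus_nat: "c \<notin> \<int>\<^sub>\<le>\<^sub>0 \<Longrightarrow> c + of_nat k \<noteq> (0 :: complex)"
  by (metis add_eq_0_iff2 minus_of_nat_in_nonpos_Ints)

lemma pochhammer_nonzero: "c \<notin> \<int>\<^sub>\<le>\<^sub>0 \<Longrightarrow> pochhammer c k \<noteq> (0 :: complex)"
  by (auto simp: pochhammer_eq_0_iff)

lemma of_real_notin_nonpos_Ints: "c > 0 \<Longrightarrow> complex_of_real c \<notin> \<int>\<^sub>\<le>\<^sub>0"
  by (auto elim!: nonpos_Ints_cases simp: complex_eq_iff)

lemma hyp2F1_coeff_Suc:
  assumes "c \<notin> \<int>\<^sub>\<le>\<^sub>0"
  shows "hyp2F1_coeff a b c (Suc k) =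
           hyp2F1_coeff a b c k * ((a + of_nat k) * (b + of_nat k) / ((c + of_nat k) * (1 + of_nat k)))"
  using pochhammer_nonzero[OF assms, of k] nonpos_Ints_plus_nat[OF assms, of k]
  by (simp add: hyp2F1_coeff_def pochhammer_Suc field_simps)

lemma hyp2F1_coeff_ratio_tendsto:
  "(\<lambda>n. (a + of_nat n) / (c + of_nat n) :: complex) \<longlonglongrightarrow> 1"
proof -
  have inf: "filterlim (\<lambda>n. c + of_nat n :: complex) at_infinity sequentially"
    by (intro tendsto_add_filterlim_at_infinity[OF tendsto_const] tendsto_of_nat)
  have "(\<lambda>n. 1 + (a - c) / (c + of_nat n)) \<longlonglongrightarrow> 1 + 0"
    by (intro tendsto_intros tendsto_divide_0[OF tendsto_const] inf)
  moreover have "eventually (\<lambda>n. c + of_nat n \<noteq> 0) sequentially"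
    using inf by (rule filterlim_at_infinity_imp_eventually_ne)
  then have "eventually (\<lambda>n. 1 + (a - c) / (c + of_nat n) = (a + of_nat n) / (c + of_nat n)) sequentially"
    by eventually_elim (simp add: field_simps)
  ultimately show ?thesis by (simp add: tendsto_cong)
qed

lemma hyp2F1_series_sums:
  assumes c: "c \<notin> \<int>\<^sub>\<le>\<^sub>0" and z: "norm z < 1"
  shows "(\<lambda>k. hyp2F1_coeff a b c k * z ^ k) sums hyp2F1_series a b c z"
proof -
  define r where "r = (\<lambda>n. (a + of_nat n) / (c + of_nat n) * ((b + of_nat n) / (1 + of_nat n)) * z)"
  have "r \<longlonglongrightarrow> 1 * 1 * z"
    unfolding r_def by (intro tendsto_intros hyp2F1_coeff_ratio_tendsto)
  then have "(\<lambda>n. norm (r n)) \<longlonglongrightarrow> norm z"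
    by (intro tendsto_norm) simp
  then have "eventually (\<lambda>n. norm (r n) < (1 + norm z) / 2) sequentially"
    using z by (intro order_tendstoD) auto
  then obtain N where N: "\<And>n. n \<ge> N \<Longrightarrow> norm (r n) < (1 + norm z) / 2"
    by (auto simp: eventually_sequentially)
  have "summable (\<lambda>k. hyp2F1_coeff a b c k * z ^ k)"
  proof (rule summable_ratio_test)
    show "(1 + norm z) / 2 < 1" using z by simp
    fix n assume n: "n \<ge> N"
    have "hyp2F1_coeff a b c (Suc n) * z ^ Suc n = r n * (hyp2F1_coeff a b c n * z ^ n)"
      by (simp add: hyp2F1_coeff_Suc[OF c] r_def)
    then have "norm (hyp2F1_coeff a b c (Suc n) * z ^ Suc n) = norm (r n) * norm (hyp2F1_coeff a b c n * z ^ n)"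
      by (simp only: norm_mult)
    also have "\<dots> \<le> (1 + norm z) / 2 * norm (hyp2F1_coeff a b c n * z ^ n)"
      using N[OF n] by (intro mult_right_mono) auto
    finally show "norm (hyp2F1_coeff a b c (Suc n) * z ^ Suc n) \<le>
                    (1 + norm z) / 2 * norm (hyp2F1_coeff a b c n * z ^ n)" .
  qed
  then show ?thesis
    unfolding hyp2F1_series_def hyp2F1_coeff_def[symmetric] by (simp add: summable_sums)
qed

lemma is_hyp2F1_continuation_iff:
  assumes "c \<notin> \<int>\<^sub>\<le>\<^sub>0"
  shows "is_hyp2F1_continuation a b c f \<longleftrightarrow>
           f holomorphic_on hyp2F1_domain \<and>
           (\<forall>z. norm z < 1 \<longrightarrow> (\<lambda>k. hyp2F1_coeff a b c k * z ^ k) sums f z)"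
proof -
  have "f z = hyp2F1_series a b c z \<longleftrightarrow> (\<lambda>k. hyp2F1_coeff a b c k * z ^ k) sums f z"
    if "norm z < 1" for z
    using hyp2F1_series_sums[OF assms that, of a b] sums_unique2 by metis
  then show ?thesis
    unfolding is_hyp2F1_continuation_def by (simp add: Ball_def)
qed

text \<open>
  The seed for Euler's integral: for \<open>b = c\<close> the series is the binomial series.
\<close>

lemma is_hyp2F1_continuation_powr:
  assumes "c \<notin> \<int>\<^sub>\<le>\<^sub>0"
  shows "is_hyp2F1_continuation a c c (\<lambda>z. (1 - z) powr (- a))"
  unfolding is_hyp2F1_continuation_iff[OF assms]
proof (intro conjI allI impI)
  show "(\<lambda>z. (1 - z) powr - a) holomorphic_on hyp2F1_domain"
    by (auto intro!: holomorphic_intros simp: hyp2F1_domain_iff complex_nonpos_Reals_iff)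
  fix z :: complex assume "norm z < 1"
  then have binomial: "(\<lambda>k. (- a gchoose k) * (- z) ^ k) sums (1 + - z) powr - a"
    by (intro gen_binomial_complex) simp
  have coeff: "(- a gchoose k) * (- z) ^ k = hyp2F1_coeff a c c k * z ^ k" for k
  proof -
    have "(- z) ^ k = (- 1) ^ k * z ^ k" by (rule power_minus)
    moreover have "(- 1) ^ k * (- 1) ^ k = (1 :: complex)" by (simp flip: power_mult_distrib)
    ultimately show ?thesis
      using pochhammer_nonzero[OF assms, of k] by (simp add: gbinomial_pochhammer hyp2F1_coeff_def)
  qed
  show "(\<lambda>k. hyp2F1_coeff a c c k * z ^ k) sums (1 - z) powr - a"
    using binomial unfolding coeff by (simp only: diff_conv_add_uminus)
qed

lemma powr_diff_one_shift:
  fixes t a :: real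
  assumes "0 \<le> t"
  shows "t powr (a + real k - 1) = t powr (a - 1) * t ^ k"
proof (cases "t = 0")
  case False
  have "t powr (a + real k - 1) = t powr (a - 1) * t powr real k"
    using powr_add[of t "a - 1" "real k"] by (simp add: algebra_simps)
  then show ?thesis using False assms by (simp add: powr_realpow)
qed auto

lemma beta_weight_moment:
  assumes "a > 0" "b > 0"
  shows "((\<lambda>t. of_real (t powr (a - 1) * (1 - t) powr (b - 1)) * of_real t ^ k * of_real (1 - t) ^ i)
            has_integral complex_of_real (Beta (a + real k) (b + real i))) {0..1}"
proof -
  have "((\<lambda>t. t powr (a + real k - 1) * (1 - t) powr (b + real i - 1)) has_integral
           Beta (a + real k) (b + real i)) {0..1}"
    using assms by (intro has_integral_Beta_real) auto
  then have "((\<lambda>t. complex_of_real (t powr (a + real k - 1) * (1 - t) powr (b + real i - 1)))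
               has_integral of_real (Beta (a + real k) (b + real i))) {0..1}"
    by (rule has_integral_of_real)
  moreover have "complex_of_real (t powr (a + real k - 1) * (1 - t) powr (b + real i - 1)) =
      of_real (t powr (a - 1) * (1 - t) powr (b - 1)) * of_real t ^ k * of_real (1 - t) ^ i"
    if "t \<in> {0..1}" for t
  proof -
    have "t powr (a + real k - 1) = t powr (a - 1) * t ^ k"
         "(1 - t) powr (b + real i - 1) = (1 - t) powr (b - 1) * (1 - t) ^ i"
      using that by (auto intro: powr_diff_one_shift)
    then show ?thesis by (simp only: of_real_mult of_real_power mult_ac)
  qed
  ultimately show ?thesis by (rule has_integral_eq[rotated])
qed

lemma beta_weight_absolutely_integrable:
  assumes "a > 0" "b > 0"
  shows "(\<lambda>t. complex_of_real (t powr (a - 1) * (1 - t) powr (b - 1))) absolutely_integrable_on {0..1}"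
proof -
  have "(\<lambda>t. t powr (a - 1) * (1 - t) powr (b - 1)) absolutely_integrable_on {0..1}"
    using has_integral_Beta_real[OF assms]
    by (intro nonnegative_absolutely_integrable_1) (auto simp: has_integral_integrable)
  then have "(of_real \<circ> (\<lambda>t. t powr (a - 1) * (1 - t) powr (b - 1)) :: real \<Rightarrow> complex) absolutely_integrable_on {0..1}"
    by (rule absolutely_integrable_linear) (rule bounded_linear_of_real)
  then show ?thesis by (simp add: o_def)
qed

lemma Beta_ratio_pochhammer:
  assumes "a > 0" "b > 0"
  shows "Beta (a + real k) b / Beta a b = pochhammer a k / pochhammer (a + b) k"
proof -
  have "a \<notin> \<int>\<^sub>\<le>\<^sub>0" "a + b \<notin> \<int>\<^sub>\<le>\<^sub>0" using assms by (auto elim!: nonpos_Ints_cases)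
  moreover have "Gamma a > 0" "Gamma b > 0" "Gamma (a + b) > 0" "Gamma (a + b + real k) > 0"
    using assms by (auto intro!: Gamma_real_pos)
  ultimately show ?thesis
    by (simp add: Beta_def pochhammer_Gamma field_simps)
qed

lemma is_hyp2F1_continuation_Euler:
  assumes "0 < b" "b < (c :: real)"
  shows "\<exists>f. is_hyp2F1_continuation a (of_real b) (of_real c) f"
proof -
  define q where "q = (\<lambda>t. complex_of_real (t powr (b - 1) * (1 - t) powr (c - b - 1)))"
  define \<Phi> :: "complex \<Rightarrow> complex" where "\<Phi> = (\<lambda>z. (1 - z) powr (- a))"
  have c: "complex_of_real c \<notin> \<int>\<^sub>\<le>\<^sub>0" using assms by (intro of_real_notin_nonpos_Ints) auto
  have B: "Beta b (c - b) > 0" using assms by (auto simp: Beta_def intro!: divide_pos_pos mult_pos_pos Gamma_real_pos)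
  have q: "q absolutely_integrable_on {0..1}"
    unfolding q_def using assms by (intro beta_weight_absolutely_integrable) auto
  have \<Phi>: "\<Phi> holomorphic_on hyp2F1_domain"
    "\<And>z. norm z < 1 \<Longrightarrow> (\<lambda>k. hyp2F1_coeff a (of_real c) (of_real c) k * z ^ k) sums \<Phi> z"
    using is_hyp2F1_continuation_powr[OF c, of a] by (auto simp: is_hyp2F1_continuation_iff[OF c] \<Phi>_def)
  define V where "V = (\<lambda>v. integral {0..1} (\<lambda>t. q t * \<Phi> (v * of_real t)))"
  have "is_hyp2F1_continuation a (of_real b) (of_real c) (\<lambda>v. V v / of_real (Beta b (c - b)))"
    unfolding is_hyp2F1_continuation_iff[OF c]
  proof (intro conjI allI impI)
    show "(\<lambda>v. V v / of_real (Beta b (c - b))) holomorphic_on hyp2F1_domain"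
      using moment_transform_holomorphic[OF q \<Phi>(1)] B unfolding V_def
      by (intro holomorphic_intros) auto
    fix v :: complex assume v: "norm v < 1"
    have mom: "integral {0..1} (\<lambda>t. q t * of_real t ^ k) = of_real (Beta (b + real k) (c - b))" for k
      unfolding q_def using assms beta_weight_moment[of b "c - b" k 0] by (intro integral_unique) simp
    have "(\<lambda>k. hyp2F1_coeff a (of_real c) (of_real c) k * of_real (Beta (b + real k) (c - b)) * v ^ k) sums V v"
      using moment_transform_sums[OF q \<Phi>(1) \<Phi>(2) v] by (simp add: mom V_def)
    then have "(\<lambda>k. hyp2F1_coeff a (of_real c) (of_real c) k * of_real (Beta (b + real k) (c - b)) * v ^ k
                  / of_real (Beta b (c - b))) sums (V v / of_real (Beta b (c - b)))"
      by (rule sums_divide)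
    moreover have "hyp2F1_coeff a (of_real c) (of_real c) k * of_real (Beta (b + real k) (c - b)) * v ^ k
                  / of_real (Beta b (c - b)) = hyp2F1_coeff a (of_real b) (of_real c) k * v ^ k" for k
    proof -
      have "complex_of_real (Beta (b + real k) (c - b)) / of_real (Beta b (c - b)) =
              of_real (pochhammer b k / pochhammer c k)"
        using Beta_ratio_pochhammer[of b "c - b" k] assms by (simp flip: of_real_divide)
      then show ?thesis
        using pochhammer_nonzero[OF c, of k] B
        by (simp add: hyp2F1_coeff_def pochhammer_of_real divide_simps)
    qed
    ultimately show "(\<lambda>k. hyp2F1_coeff a (of_real b) (of_real c) k * v ^ k) sums (V v / of_real (Beta b (c - b)))"
      by simp
  qed
  then show ?thesis by blast
qed

text \<open>
  The operator \<open>1 + (z / c) d/dz\<close> multiplies the \<open>k\<close>-th coefficient by \<open>(c + k) / c\<close>, and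
  \<open>(c + k) / (c (c + 1)\<^sub>k) = 1 / (c)\<^sub>k\<close>. Hence it lowers the third parameter, without leaving the
  domain of holomorphy.
\<close>

lemma is_hyp2F1_continuation_lower:
  assumes c: "c \<notin> \<int>\<^sub>\<le>\<^sub>0" and f: "is_hyp2F1_continuation a b (c + 1) f"
  shows "is_hyp2F1_continuation a b c (\<lambda>z. f z + z / c * deriv f z)"
proof -
  have c1: "c + 1 \<notin> \<int>\<^sub>\<le>\<^sub>0" using c plus_one_in_nonpos_Ints_imp by blast
  have c0: "c \<noteq> 0" using c by auto
  have hol: "f holomorphic_on hyp2F1_domain"
    and sums: "\<And>z. norm z < 1 \<Longrightarrow> (\<lambda>k. hyp2F1_coeff a b (c + 1) k * z ^ k) sums f z"
    using f by (auto simp: is_hyp2F1_continuation_iff[OF c1])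
  show ?thesis
    unfolding is_hyp2F1_continuation_iff[OF c]
  proof (intro conjI allI impI)
    show "(\<lambda>z. f z + z / c * deriv f z) holomorphic_on hyp2F1_domain"
      using c0 by (intro holomorphic_intros hol holomorphic_deriv) auto
    fix z :: complex assume z: "norm z < 1"
    let ?\<phi> = "hyp2F1_coeff a b (c + 1)"
    have "(f has_field_derivative deriv f z) (at z)"
      using z ball_subset_hyp2F1_domain by (intro holomorphic_derivI[OF hol]) auto
    from termdiffs_sums_strong[OF sums this z]
    have "(\<lambda>k. of_nat (Suc k) * ?\<phi> (Suc k) * z ^ k * z) sums (deriv f z * z)"
      unfolding diffs_def by (intro sums_mult2)
    then have "(\<lambda>k. of_nat (Suc k) * ?\<phi> (Suc k) * z ^ Suc k) sums (z * deriv f z)"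
      by (simp add: mult_ac)
    then have "(\<lambda>k. of_nat k * ?\<phi> k * z ^ k) sums (z * deriv f z)"
      by (subst (asm) sums_Suc_iff) simp
    then have "(\<lambda>k. ?\<phi> k * z ^ k + 1 / c * (of_nat k * ?\<phi> k * z ^ k)) sums (f z + 1 / c * (z * deriv f z))"
      by (intro sums_add sums_mult sums z)
    moreover have "?\<phi> k * z ^ k + 1 / c * (of_nat k * ?\<phi> k * z ^ k) = hyp2F1_coeff a b c k * z ^ k" for k
    proof -
      have "c * pochhammer (c + 1) k = pochhammer c k * (c + of_nat k)"
        by (simp flip: pochhammer_rec pochhammer_Suc)
      then have "?\<phi> k * (1 + of_nat k / c) = hyp2F1_coeff a b c k"
        using pochhammer_nonzero[OF c, of k] pochhammer_nonzero[OF c1, of k] c0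
        by (simp add: hyp2F1_coeff_def divide_simps) (simp add: algebra_simps)
      moreover have "?\<phi> k * z ^ k + 1 / c * (of_nat k * ?\<phi> k * z ^ k) = (?\<phi> k * (1 + of_nat k / c)) * z ^ k"
        by (simp add: algebra_simps)
      ultimately show ?thesis by simp
    qed
    ultimately show "(\<lambda>k. hyp2F1_coeff a b c k * z ^ k) sums (f z + z / c * deriv f z)"
      by simp
  qed
qed

text \<open>
  Euler's integral converges only for \<open>c > b > 0\<close>; for other positive \<open>c\<close> start from a sufficiently
  large \<open>c + N\<close> and descend.
\<close>

lemma ex_hyp2F1_continuation:
  assumes b: "0 < b" and c: "0 < (c :: real)"
  shows "\<exists>f. is_hyp2F1_continuation a (of_real b) (of_real c) f"
proof -
  have "b < c + real N \<Longrightarrow> \<exists>f. is_hyp2F1_continuation a (of_real b) (of_real c) f" for N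
    using c
  proof (induction N arbitrary: c)
    case 0
    then show ?case by (intro is_hyp2F1_continuation_Euler b) simp
  next
    case (Suc N)
    then have "\<exists>f. is_hyp2F1_continuation a (of_real b) (of_real (c + 1)) f"
      by (intro Suc.IH) auto
    then obtain f where "is_hyp2F1_continuation a (of_real b) (of_real c + 1) f"
      by auto
    from is_hyp2F1_continuation_lower[OF of_real_notin_nonpos_Ints[OF \<open>0 < c\<close>] this]
    show ?case by (rule exI[where x = "\<lambda>z. f z + z / of_real c * deriv f z"])
  qed
  moreover obtain N :: nat where "b < c + real N"
    using reals_Archimedean2[of "b - c"] by (auto simp: algebra_simps)
  ultimately show ?thesis by blast
qed

lemma hyp2F1_series_commute: "hyp2F1_series a b c = hyp2F1_series b a c"
  by (simp add: hyp2F1_series_def[abs_def] mult.commute)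

lemma is_hyp2F1_continuation_commute:
  "is_hyp2F1_continuation a b c f \<longleftrightarrow> is_hyp2F1_continuation b a c f"
  by (simp add: is_hyp2F1_continuation_def hyp2F1_series_commute[of a])

lemma hyp2F1_series_polynomial:
  assumes "a \<in> \<int>\<^sub>\<le>\<^sub>0"
  shows "is_hyp2F1_continuation a b c (hyp2F1_series a b c)"
proof -
  obtain n where n: "a = - of_nat n" using assms by (elim nonpos_Ints_cases')
  have "hyp2F1_series a b c = (\<lambda>z. \<Sum>k\<le>n. pochhammer a k * pochhammer b k / (pochhammer c k * fact k) * z ^ k)"
    unfolding hyp2F1_series_def
    by (intro ext suminf_finite) (auto simp: n pochhammer_of_nat_eq_0_iff)
  moreover have "(\<lambda>z. \<Sum>k\<le>n. pochhammer a k * pochhammer b k / (pochhammer c k * fact k) * z ^ k)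
                  holomorphic_on hyp2F1_domain"
    by (rule holomorphic_on_sum, rule holomorphic_on_mult) (intro holomorphic_intros)+
  ultimately have "hyp2F1_series a b c holomorphic_on hyp2F1_domain"
    by (simp only:)
  then show ?thesis by (simp add: is_hyp2F1_continuation_def)
qed

text \<open>
  A choice among continuations is one as soon as any exists. When a parameter is a
  nonpositive integer the value is given by the polynomial series, which is its own continuation.
\<close>

lemma hyp2F1_is_continuation:
  assumes "a \<in> \<int>\<^sub>\<le>\<^sub>0 \<or> b \<in> \<int>\<^sub>\<le>\<^sub>0 \<or> (b \<in> \<real> \<and> Re b > 0)" and "c > 0"
  shows "is_hyp2F1_continuation a b (of_real c) (hyp2F1 a b (of_real c))"
proof (cases "a \<in> \<int>\<^sub>\<le>\<^sub>0 \<or> b \<in> \<int>\<^sub>\<le>\<^sub>0")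
  case True
  then have "is_hyp2F1_continuation a b (of_real c) (hyp2F1_series a b (of_real c))"
  proof
    assume "b \<in> \<int>\<^sub>\<le>\<^sub>0"
    then show ?thesis
      using hyp2F1_series_polynomial[of b a "of_real c"]
      by (subst is_hyp2F1_continuation_commute, subst hyp2F1_series_commute)
  qed (rule hyp2F1_series_polynomial)
  then show ?thesis using True by (simp add: hyp2F1_def[abs_def])
next
  case False
  then have "\<exists>f. is_hyp2F1_continuation a b (of_real c) f"
    using assms ex_hyp2F1_continuation[of "Re b" c a] by auto
  then show ?thesis using False by (simp add: hyp2F1_def[abs_def] someI_ex)
qed

section \<open>The hypergeometric equation\<close>

text \<open>
  In terms of Taylor coefficients the hypergeometric equation is the two-term recurrence of the
  hypergeometric series. This gives both that continuations solve the equation and that the equation,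
  with the value at \<open>0\<close>, determines them.
\<close>

lemma hypergeometric_ODE_fps_nth:
  fixes F :: "complex fps"
  shows "(fps_X * fps_deriv (fps_deriv F) - fps_X * (fps_X * fps_deriv (fps_deriv F))
           + fps_const c * fps_deriv F - fps_const (a + b + 1) * (fps_X * fps_deriv F)
           - fps_const (a * b) * F) $ n =
         (c + of_nat n) * (1 + of_nat n) * F $ Suc n - (a + of_nat n) * (b + of_nat n) * F $ n"
proof (cases n)
  case (Suc m)
  then show ?thesis by (cases m) (simp_all add: algebra_simps)
qed simp

lemma hypergeometric_ODE_has_fps_expansion:
  assumes "f has_fps_expansion F"
  shows "(\<lambda>z. z * deriv (deriv f) z - z * (z * deriv (deriv f) z) + c * deriv f z
             - (a + b + 1) * (z * deriv f z) - (a * b) * f z) has_fps_expansion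
           (fps_X * fps_deriv (fps_deriv F) - fps_X * (fps_X * fps_deriv (fps_deriv F))
           + fps_const c * fps_deriv F - fps_const (a + b + 1) * (fps_X * fps_deriv F)
           - fps_const (a * b) * F)"
  by (intro fps_expansion_intros assms)

lemma hyp2F1_continuation_has_fps_expansion:
  assumes "c \<notin> \<int>\<^sub>\<le>\<^sub>0" "is_hyp2F1_continuation a b c f"
  shows "f has_fps_expansion Abs_fps (hyp2F1_coeff a b c)"
proof (rule has_fps_expansionI)
  have "eventually (\<lambda>z. z \<in> ball 0 1) (nhds (0 :: complex))"
    by (intro eventually_nhds_in_open) auto
  then show "\<forall>\<^sub>F u in nhds 0. (\<lambda>n. Abs_fps (hyp2F1_coeff a b c) $ n * u ^ n) sums f u"
    by eventually_elim (use assms in \<open>auto simp: is_hyp2F1_continuation_iff\<close>)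
qed

lemma hyp2F1_continuation_ODE:
  assumes c: "c \<notin> \<int>\<^sub>\<le>\<^sub>0" and f: "is_hyp2F1_continuation a b c f" and z: "z \<in> hyp2F1_domain"
  shows "z * (1 - z) * deriv (deriv f) z + (c - (a + b + 1) * z) * deriv f z - a * b * f z = 0"
proof -
  have hol: "f holomorphic_on hyp2F1_domain" using f by (simp add: is_hyp2F1_continuation_def)
  have zero: "fps_X * fps_deriv (fps_deriv F) - fps_X * (fps_X * fps_deriv (fps_deriv F))
           + fps_const c * fps_deriv F - fps_const (a + b + 1) * (fps_X * fps_deriv F)
           - fps_const (a * b) * F = 0" if "F = Abs_fps (hyp2F1_coeff a b c)" for F
  proof (rule fps_ext, unfold hypergeometric_ODE_fps_nth)
    fix n
    show "(c + of_nat n) * (1 + of_nat n) * F $ Suc n - (a + of_nat n) * (b + of_nat n) * F $ n = 0 $ n"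
      using nonpos_Ints_plus_nat[OF c, of n] of_nat_Suc[of n, where ?'a = complex]
      by (simp add: that hyp2F1_coeff_Suc[OF c] divide_simps flip: of_nat_Suc)
  qed
  have "(\<lambda>z. z * deriv (deriv f) z - z * (z * deriv (deriv f) z) + c * deriv f z
             - (a + b + 1) * (z * deriv f z) - (a * b) * f z) has_fps_expansion 0"
    using hypergeometric_ODE_has_fps_expansion[OF hyp2F1_continuation_has_fps_expansion[OF c f], of c a b]
    by (subst (asm) zero[OF refl])
  then have "z * deriv (deriv f) z - z * (z * deriv (deriv f) z) + c * deriv f z
             - (a + b + 1) * (z * deriv f z) - (a * b) * f z = 0"
    by (rule has_fps_expansion_0_analytic_continuation)
       (use z in \<open>auto intro!: holomorphic_intros holomorphic_deriv hol\<close>)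
  then show ?thesis by (simp add: algebra_simps)
qed

text \<open>
  Since \<open>c\<close> is not a nonpositive integer, the recurrence can be solved for the next coefficient. So the
  solution regular at \<open>0\<close> is unique up to scaling, although the equation has order two.
\<close>

lemma hyp2F1_continuation_unique_ODE:
  assumes c: "c \<notin> \<int>\<^sub>\<le>\<^sub>0" and f: "is_hyp2F1_continuation a b c f"
    and A: "open A" "connected A" "0 \<in> A" "A \<subseteq> hyp2F1_domain"
    and g': "\<And>z. z \<in> A \<Longrightarrow> (g has_field_derivative g' z) (at z)"
    and g'': "\<And>z. z \<in> A \<Longrightarrow> (g' has_field_derivative g'' z) (at z)"
    and ODE: "\<And>z. z \<in> A \<Longrightarrow>
                z * (1 - z) * g'' z + (c - (a + b + 1) * z) * g' z - a * b * g z = 0"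
    and g0: "g 0 = 1" and z: "z \<in> A"
  shows "g z = f z"
proof -
  have holg: "g holomorphic_on A"
    using g' A by (auto simp: holomorphic_on_open)
  define G where "G = fps_expansion g 0"
  have G: "g has_fps_expansion G"
    unfolding G_def using A holg by (intro has_fps_expansion_fps_expansion)
  have dg: "deriv g z = g' z" if "z \<in> A" for z using g'[OF that] by (rule DERIV_imp_deriv)
  have ddg: "deriv (deriv g) z = g'' z" if "z \<in> A" for z
  proof -
    have "eventually (\<lambda>z. z \<in> A) (nhds z)" using A that by (intro eventually_nhds_in_open)
    then have "eventually (\<lambda>z. deriv g z = g' z) (nhds z)" by eventually_elim (rule dg)
    then have "deriv (deriv g) z = deriv g' z" by (intro deriv_cong_ev) auto
    then show ?thesis using g''[OF that] by (simp add: DERIV_imp_deriv)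
  qed
  have "eventually (\<lambda>z. z \<in> A) (nhds 0)" using A by (intro eventually_nhds_in_open)
  then have "eventually (\<lambda>z. z * deriv (deriv g) z - z * (z * deriv (deriv g) z) + c * deriv g z
             - (a + b + 1) * (z * deriv g z) - (a * b) * g z = 0) (nhds 0)"
  proof eventually_elim
    case (elim z)
    then show ?case using ODE[OF elim] by (simp add: dg ddg algebra_simps)
  qed
  then have "(\<lambda>z. z * deriv (deriv g) z - z * (z * deriv (deriv g) z) + c * deriv g z
             - (a + b + 1) * (z * deriv g z) - (a * b) * g z) has_fps_expansion 0"
    by (simp only: has_fps_expansion_0_iff)
  with hypergeometric_ODE_has_fps_expansion[OF G, of c a b] have zero: "fps_X * fps_deriv (fps_deriv G) - fps_X * (fps_X * fps_deriv (fps_deriv G))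
           + fps_const c * fps_deriv G - fps_const (a + b + 1) * (fps_X * fps_deriv G)
           - fps_const (a * b) * G = 0"
    by (rule fps_expansion_unique_complex)
  have rec: "(c + of_nat n) * (1 + of_nat n) * G $ Suc n = (a + of_nat n) * (b + of_nat n) * G $ n" for n
    using hypergeometric_ODE_fps_nth[of G c a b n] unfolding zero by simp
  have "G $ n = hyp2F1_coeff a b c n" for n
  proof (induction n)
    case 0
    show ?case using has_fps_expansion_imp_0_eq_fps_nth_0[OF G] g0 by simp
  next
    case (Suc n)
    have "1 + of_nat n \<noteq> (0 :: complex)" by (metis of_nat_Suc of_nat_neq_0)
    then show ?case
      using rec[of n] Suc nonpos_Ints_plus_nat[OF c, of n]
      by (simp add: hyp2F1_coeff_Suc[OF c] divide_simps mult_ac)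
  qed
  then have "G = Abs_fps (hyp2F1_coeff a b c)" by (simp add: fps_eq_iff)
  then have "(\<lambda>z. g z - f z) has_fps_expansion G - G"
    using hyp2F1_continuation_has_fps_expansion[OF c f] by (intro fps_expansion_intros G) simp
  then have "(\<lambda>z. g z - f z) has_fps_expansion 0" by simp
  moreover have "f holomorphic_on A"
    using f A by (auto simp: is_hyp2F1_continuation_def intro: holomorphic_on_subset)
  then have "(\<lambda>z. g z - f z) holomorphic_on A" by (intro holomorphic_intros holg)
  ultimately have "g z - f z = 0"
    by (rule has_fps_expansion_0_analytic_continuation) (use A z in auto)
  then show ?thesis by simp
qed

section \<open>A quadratic transformation\<close>

text \<open>
  The next two identities say that the right-hand side \<open>p(w) \<Phi>(s(w))\<close> of the quadratic transformation
  satisfies the hypergeometric equation of the left-hand side. With \<open>\<zeta> = 1 - 2 w\<close>, \<open>i = 1 / \<zeta>\<close>,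
  \<open>j = 1 / (1 + \<zeta>)\<close>, \<open>u = w (1 - w)\<close> and \<open>L = p' / p\<close>, eliminating \<open>\<Phi>''\<close> through the equation of \<open>\<Phi>\<close> leaves
  a linear combination of \<open>\<Phi>\<close> and \<open>\<Phi>'\<close>; these are its two coefficients.
\<close>

lemma quadratic_ODE_coeff_0:
  fixes \<zeta> \<beta> \<gamma> :: complex
  assumes "i * \<zeta> = 1" "j * (1 + \<zeta>) = 1" "4 * u = 1 - \<zeta>\<^sup>2"
    "A = \<gamma> + \<beta> + 1" "L = 2 * A * i - 2 * \<beta> * j"
  shows "u * (L\<^sup>2 + (4 * A * i\<^sup>2 - 4 * \<beta> * j\<^sup>2)) + (\<beta> + \<zeta>) * L
           + \<gamma> * (\<gamma> + 1) - A * (A + 1) * i\<^sup>2 = 0"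
proof -
  have "4 * (u * (L\<^sup>2 + (4 * A * i\<^sup>2 - 4 * \<beta> * j\<^sup>2)) + (\<beta> + \<zeta>) * L
           + \<gamma> * (\<gamma> + 1) - A * (A + 1) * i\<^sup>2) = 0"
    using assms(1-3) unfolding assms(4,5) by algebra
  then show ?thesis by (simp only: mult_eq_0_iff) simp
qed

lemma quadratic_ODE_coeff_1:
  fixes \<zeta> \<beta> A :: complex
  assumes "i * \<zeta> = 1" "j * (1 + \<zeta>) = 1" "4 * u = 1 - \<zeta>\<^sup>2" "L = 2 * A * i - 2 * \<beta> * j"
  shows "u * (2 * L * (- 4 * i ^ 3) - 24 * i ^ 4) - 4 * (\<beta> + \<zeta>) * i ^ 3
           + 2 * i\<^sup>2 * (2 * (1 + \<beta>) - (2 * A + 3) * (1 - i\<^sup>2)) = 0"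
proof -
  have "4 * (u * (2 * L * (- 4 * i ^ 3) - 24 * i ^ 4) - 4 * (\<beta> + \<zeta>) * i ^ 3
           + 2 * i\<^sup>2 * (2 * (1 + \<beta>) - (2 * A + 3) * (1 - i\<^sup>2))) = 0"
    using assms(1-3) unfolding assms(4) by algebra
  then show ?thesis by (simp only: mult_eq_0_iff) simp
qed

text \<open>
  A value in \<open>[1, \<infinity>)\<close> would make \<open>1 / \<zeta>\<close> purely imaginary.
\<close>

lemma quadratic_arg_in_domain:
  assumes "Re \<zeta> > 0"
  shows "1 - (1 / \<zeta>)\<^sup>2 \<in> hyp2F1_domain"
proof (rule ccontr)
  assume "1 - (1 / \<zeta>)\<^sup>2 \<notin> hyp2F1_domain"
  then have *: "Im ((1 / \<zeta>)\<^sup>2) = 0" "Re ((1 / \<zeta>)\<^sup>2) \<le> 0" by (auto simp: hyp2F1_domain_iff)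
  have re: "Re (1 / \<zeta>) > 0" using assms by (simp add: Re_divide sum_power2_gt_zero_iff)
  have "2 * Re (1 / \<zeta>) * Im (1 / \<zeta>) = 0" using *(1) by (simp only: Im_power2)
  with re have "Im (1 / \<zeta>) = 0" by simp
  then have "Re ((1 / \<zeta>)\<^sup>2) = (Re (1 / \<zeta>))\<^sup>2" by (simp only: Re_power2) simp
  with *(2) re show False by (simp add: not_le[symmetric])
qed

text \<open>
  For \<open>Re \<zeta> > 0\<close> the number \<open>1 - \<zeta>\<^sup>-\<^sup>2\<close> lies in the cut plane and the powers are holomorphic. In terms of
  \<open>w = (1 - \<zeta>) / 2\<close> this is the half-plane \<open>Re w < 1 / 2\<close>, which contains \<open>0\<close>. There the right-hand side
  is a regular solution of the hypergeometric equation of \<open>f\<close> with value \<open>1\<close> at \<open>0\<close>, so it equals \<open>f\<close>.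
\<close>

lemma quadratic_transformation:
  fixes \<beta> \<gamma> \<zeta> :: complex
  defines "A \<equiv> \<gamma> + \<beta> + 1"
  assumes c: "1 + \<beta> \<notin> \<int>\<^sub>\<le>\<^sub>0"
    and f: "is_hyp2F1_continuation (- \<gamma>) (\<gamma> + 1) (1 + \<beta>) f"
    and \<Phi>: "is_hyp2F1_continuation (A / 2) ((A + 1) / 2) (1 + \<beta>) \<Phi>"
    and \<zeta>: "Re \<zeta> > 0"
  shows "f ((1 - \<zeta>) / 2) = ((1 + \<zeta>) / 2) powr \<beta> * \<zeta> powr (- A) * \<Phi> (1 - (1 / \<zeta>)\<^sup>2)"
proof -
  define H where "H = {w :: complex. Re w < 1 / 2}"
  define i where "i = (\<lambda>w :: complex. 1 / (1 - 2 * w))"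
  define j where "j = (\<lambda>w :: complex. 1 / (2 - 2 * w))"
  define L where "L = (\<lambda>w. 2 * A * i w - 2 * \<beta> * j w)"
  define L' where "L' = (\<lambda>w. 4 * A * (i w)\<^sup>2 - 4 * \<beta> * (j w)\<^sup>2)"
  define p where "p = (\<lambda>w. exp (\<beta> * Ln (1 - w) - A * Ln (1 - 2 * w)))"
  define s where "s = (\<lambda>w. 1 - (i w)\<^sup>2)"
  define g where "g = (\<lambda>w. p w * \<Phi> (s w))"
  define g' where "g' = (\<lambda>w. p w * (L w * \<Phi> (s w) + (- 4 * i w ^ 3) * deriv \<Phi> (s w)))"
  define g'' where "g'' = (\<lambda>w. p w * (((L w)\<^sup>2 + L' w) * \<Phi> (s w)
      + (2 * L w * (- 4 * i w ^ 3) - 24 * i w ^ 4) * deriv \<Phi> (s w)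
      + (- 4 * i w ^ 3)\<^sup>2 * deriv (deriv \<Phi>) (s w)))"
  have hol: "\<Phi> holomorphic_on hyp2F1_domain"
    using \<Phi> by (simp add: is_hyp2F1_continuation_def)
  have hol': "deriv \<Phi> holomorphic_on hyp2F1_domain" by (intro holomorphic_deriv hol) simp
  have H: "Re (1 - 2 * w) > 0" "1 - 2 * w \<noteq> 0" "Re (1 - w) > 0" "2 - 2 * w \<noteq> 0" "1 - w \<noteq> 0"
    if "w \<in> H" for w
    using that by (auto simp: H_def complex_eq_iff)
  have s: "s w \<in> hyp2F1_domain" if "w \<in> H" for w
    using quadratic_arg_in_domain[of "1 - 2 * w"] H[OF that] by (simp add: s_def i_def)
  have di: "(i has_field_derivative 2 * (i w)\<^sup>2) (at w)" if "w \<in> H" for w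
    unfolding i_def using H[OF that]
    by (auto intro!: derivative_eq_intros simp: power2_eq_square)
  have dj: "(j has_field_derivative 2 * (j w)\<^sup>2) (at w)" if "w \<in> H" for w
    unfolding j_def using H[OF that]
    by (auto intro!: derivative_eq_intros simp: power2_eq_square)
  have dL: "(L has_field_derivative L' w) (at w)" if "w \<in> H" for w
    unfolding L_def L'_def
    by (auto intro!: derivative_eq_intros di dj that)
  have ds: "(s has_field_derivative - 4 * i w ^ 3) (at w)" if "w \<in> H" for w
    unfolding s_def
    by (auto intro!: derivative_eq_intros di that simp: power2_eq_square power3_eq_cube)
  have ds': "((\<lambda>w. - 4 * i w ^ 3) has_field_derivative - 24 * i w ^ 4) (at w)" if "w \<in> H" for w
    by (auto intro!: derivative_eq_intros di that simp: power2_eq_square eval_nat_numeral)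
  have dp: "(p has_field_derivative p w * L w) (at w)" if "w \<in> H" for w
  proof -
    have "((\<lambda>w. Ln (1 - w)) has_field_derivative - (1 / (1 - w))) (at w)"
         "((\<lambda>w. Ln (1 - 2 * w)) has_field_derivative - (2 / (1 - 2 * w))) (at w)"
      using H[OF that]
      by (auto intro!: derivative_eq_intros DERIV_chain2[OF has_field_derivative_Ln]
               simp: complex_nonpos_Reals_iff divide_inverse)
    then have "(p has_field_derivative p w * (\<beta> * - (1 / (1 - w)) - A * - (2 / (1 - 2 * w)))) (at w)"
      unfolding p_def by (intro DERIV_chain2[OF DERIV_exp] DERIV_diff DERIV_cmult)
    moreover have "\<beta> * - (1 / (1 - w)) - A * - (2 / (1 - 2 * w)) = L w"
    proof -
      have "2 * \<beta> * j w = \<beta> / (1 - w)" using H[OF that] by (simp add: j_def field_simps)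
      then show ?thesis by (simp add: L_def i_def mult_ac)
    qed
    ultimately show ?thesis by simp
  qed
  have d\<Phi>: "((\<lambda>w. \<Phi> (s w)) has_field_derivative deriv \<Phi> (s w) * (- 4 * i w ^ 3)) (at w)"
    "((\<lambda>w. deriv \<Phi> (s w)) has_field_derivative deriv (deriv \<Phi>) (s w) * (- 4 * i w ^ 3)) (at w)"
    if "w \<in> H" for w
    by (rule DERIV_chain2[OF holomorphic_derivI[OF hol _ s[OF that]] ds[OF that]]
             DERIV_chain2[OF holomorphic_derivI[OF hol' _ s[OF that]] ds[OF that]], simp)+
  have dg: "(g has_field_derivative g' w) (at w)" if "w \<in> H" for w
    unfolding g_def
    by (rule DERIV_cong[OF DERIV_mult[OF dp[OF that] d\<Phi>(1)[OF that]]])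
       (simp add: g'_def algebra_simps)
  have dg': "(g' has_field_derivative g'' w) (at w)" if "w \<in> H" for w
    unfolding g'_def
    by (rule DERIV_cong[OF DERIV_mult[OF dp[OF that] DERIV_add[OF
          DERIV_mult[OF dL[OF that] d\<Phi>(1)[OF that]] DERIV_mult[OF ds'[OF that] d\<Phi>(2)[OF that]]]]])
       (simp add: g''_def algebra_simps power2_eq_square)
  have gf: "g ((1 - \<zeta>) / 2) = f ((1 - \<zeta>) / 2)"
  proof (rule hyp2F1_continuation_unique_ODE[OF c f, where A = H])
    show "open H" unfolding H_def by (intro open_Collect_less continuous_intros)
    have "convex H" unfolding H_def by (rule convex_halfspace_Re_lt)
    then show "connected H" by (rule convex_connected)
    show "H \<subseteq> hyp2F1_domain" by (auto simp: H_def hyp2F1_domain_iff)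
    show "g 0 = 1"
    proof -
      have "\<Phi> 0 = 1"
        using has_fps_expansion_imp_0_eq_fps_nth_0[OF hyp2F1_continuation_has_fps_expansion[OF c \<Phi>]]
        by simp
      then show ?thesis by (simp add: g_def p_def s_def i_def)
    qed
    show "w * (1 - w) * g'' w + (1 + \<beta> - (- \<gamma> + (\<gamma> + 1) + 1) * w) * g' w
            - - \<gamma> * (\<gamma> + 1) * g w = 0" if w: "w \<in> H" for w
    proof -
      define \<xi> where "\<xi> = 1 - 2 * w"
      define u where "u = w * (1 - w)"
      define F0 where "F0 = \<Phi> (s w)"
      define F1 where "F1 = deriv \<Phi> (s w)"
      define F2 where "F2 = deriv (deriv \<Phi>) (s w)"
      have rel: "i w * \<xi> = 1" "j w * (1 + \<xi>) = 1" "4 * u = 1 - \<xi>\<^sup>2"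
        using H[OF w] by (auto simp: i_def j_def \<xi>_def u_def power2_eq_square algebra_simps)
      note c0 = quadratic_ODE_coeff_0[OF rel A_def[THEN meta_eq_to_obj_eq] refl]
      note c1 = quadratic_ODE_coeff_1[OF rel, of "L w" A \<beta>]
      have hyp: "s w * (1 - s w) * F2 + (1 + \<beta> - (A / 2 + (A + 1) / 2 + 1) * s w) * F1
              - A / 2 * ((A + 1) / 2) * F0 = 0"
        unfolding F0_def F1_def F2_def by (rule hyp2F1_continuation_ODE[OF c \<Phi> s[OF w]])
      have "1 - s w = (i w)\<^sup>2" by (simp add: s_def)
      then have four: "4 * s w * (i w)\<^sup>2 * F2 - (A * (A + 1) * F0 - 2 * (2 * (1 + \<beta>) - (2 * A + 3) * s w) * F1)
                  = 4 * (s w * (1 - s w) * F2 + (1 + \<beta> - (A / 2 + (A + 1) / 2 + 1) * s w) * F1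
                      - A / 2 * ((A + 1) / 2) * F0)"
        by (simp only:) (simp add: field_simps)
      have ode: "4 * s w * (i w)\<^sup>2 * F2 = A * (A + 1) * F0 - 2 * (2 * (1 + \<beta>) - (2 * A + 3) * s w) * F1"
        by (subst eq_iff_diff_eq_0) (simp only: four hyp mult_zero_right)
      \<comment> \<open>The coefficient of \<open>\<Phi>''\<close>, rewritten so that the equation of \<open>\<Phi>\<close> (fact \<open>ode\<close>) applies.\<close>
      have us: "u * (- 4 * i w ^ 3)\<^sup>2 = - (i w)\<^sup>2 * (4 * s w * (i w)\<^sup>2)"
        using rel(1,3) unfolding s_def by algebra
      have "u * (((L w)\<^sup>2 + L' w) * F0 + (2 * L w * (- 4 * i w ^ 3) - 24 * i w ^ 4) * F1
               + (- 4 * i w ^ 3)\<^sup>2 * F2) + (\<beta> + \<xi>) * (L w * F0 + (- 4 * i w ^ 3) * F1) + \<gamma> * (\<gamma> + 1) * F0 = 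
            (u * ((L w)\<^sup>2 + L' w) + (\<beta> + \<xi>) * L w + \<gamma> * (\<gamma> + 1)) * F0 +
            (u * (2 * L w * (- 4 * i w ^ 3) - 24 * i w ^ 4) - 4 * (\<beta> + \<xi>) * i w ^ 3) * F1
            + (u * (- 4 * i w ^ 3)\<^sup>2) * F2"
        by (simp add: algebra_simps)
      also have "(u * (- 4 * i w ^ 3)\<^sup>2) * F2 = - (i w)\<^sup>2 * (4 * s w * (i w)\<^sup>2 * F2)"
        unfolding us by (simp add: mult_ac)
      also have "u * ((L w)\<^sup>2 + L' w) + (\<beta> + \<xi>) * L w + \<gamma> * (\<gamma> + 1) = A * (A + 1) * (i w)\<^sup>2"
        using c0 by (simp add: L_def L'_def)
      also have "u * (2 * L w * (- 4 * i w ^ 3) - 24 * i w ^ 4) - 4 * (\<beta> + \<xi>) * i w ^ 3 =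
                   - (2 * (i w)\<^sup>2 * (2 * (1 + \<beta>) - (2 * A + 3) * s w))"
        using c1 by (simp add: L_def s_def eq_neg_iff_add_eq_0)
      also have "A * (A + 1) * (i w)\<^sup>2 * F0 + - (2 * (i w)\<^sup>2 * (2 * (1 + \<beta>) - (2 * A + 3) * s w)) * F1
                   + - (i w)\<^sup>2 * (4 * s w * (i w)\<^sup>2 * F2) = 0"
        unfolding ode by (simp add: algebra_simps)
      finally have "p w * (u * (((L w)\<^sup>2 + L' w) * F0 + (2 * L w * (- 4 * i w ^ 3) - 24 * i w ^ 4) * F1
               + (- 4 * i w ^ 3)\<^sup>2 * F2) + (\<beta> + \<xi>) * (L w * F0 + (- 4 * i w ^ 3) * F1) + \<gamma> * (\<gamma> + 1) * F0) = 0"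
        by simp
      moreover have "1 + \<beta> - (- \<gamma> + (\<gamma> + 1) + 1) * w = \<beta> + \<xi>"
        by (simp add: \<xi>_def)
      ultimately show ?thesis
        unfolding g_def g'_def g''_def F0_def[symmetric] F1_def[symmetric] F2_def[symmetric] u_def[symmetric]
        by (simp only:) (simp add: algebra_simps)
    qed
  qed (use dg dg' \<zeta> in \<open>auto simp: H_def\<close>)
  have arg: "1 - (1 - \<zeta>) / 2 = (1 + \<zeta>) / 2" "1 - 2 * ((1 - \<zeta>) / 2) = \<zeta>"
    by (auto simp: field_simps)
  have "p ((1 - \<zeta>) / 2) = exp (\<beta> * Ln ((1 + \<zeta>) / 2) + - A * Ln \<zeta>)"
    unfolding p_def arg by (simp only: diff_conv_add_uminus mult_minus_left)
  moreover have "\<zeta> \<noteq> 0" "(1 + \<zeta>) / 2 \<noteq> 0" using \<zeta> by (auto simp: complex_eq_iff)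
  ultimately have "p ((1 - \<zeta>) / 2) = ((1 + \<zeta>) / 2) powr \<beta> * \<zeta> powr (- A)"
    by (simp only: powr_def exp_add if_False)
  moreover have "s ((1 - \<zeta>) / 2) = 1 - (1 / \<zeta>)\<^sup>2"
    unfolding s_def i_def arg ..
  ultimately show ?thesis using gf by (simp only: g_def)
qed

section \<open>Integrating against Jacobi polynomials\<close>

lemma jacobi_P_eq_sum:
  "jacobi_P n (of_real \<alpha>) (of_real \<beta>) (of_real (2 * t - 1)) =
     (\<Sum>i\<le>n. of_real (pochhammer (\<alpha> + 1) n / fact n *
          (pochhammer (- real n) i * pochhammer (real n + \<alpha> + \<beta> + 1) i / (pochhammer (\<alpha> + 1) i * fact i)))
          * of_real (1 - t) ^ i)"
proof -
  have arg: "(1 - of_real (2 * t - 1)) / 2 = complex_of_real (1 - t)" by (simp add: field_simps)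
  have series: "hyp2F1_series (- of_nat n) b c z =
          (\<Sum>i\<le>n. pochhammer (- of_nat n) i * pochhammer b i / (pochhammer c i * fact i) * z ^ i)" for b c z
    unfolding hyp2F1_series_def
    by (intro suminf_finite) (auto simp: pochhammer_of_nat_eq_0_iff)
  have "jacobi_P n (of_real \<alpha>) (of_real \<beta>) (of_real (2 * t - 1)) =
          pochhammer (of_real \<alpha> + 1) n / fact n * (\<Sum>i\<le>n. pochhammer (- of_nat n) i
            * pochhammer (of_nat n + of_real \<alpha> + of_real \<beta> + 1) i
            / (pochhammer (of_real \<alpha> + 1) i * fact i) * complex_of_real (1 - t) ^ i)"
    unfolding jacobi_P_def arg hyp2F1_def
    by (simp only: minus_of_nat_in_nonpos_Ints simp_thms if_True series)
  also have "\<dots> = pochhammer (of_real (\<alpha> + 1)) n / fact n * (\<Sum>i\<le>n. pochhammer (of_real (- real n)) i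
            * pochhammer (of_real (real n + \<alpha> + \<beta> + 1)) i
            / (pochhammer (of_real (\<alpha> + 1)) i * fact i) * complex_of_real (1 - t) ^ i)"
    by (simp only: of_real_add of_real_minus of_real_of_nat_eq of_real_1)
  also have "\<dots> = (\<Sum>i\<le>n. of_real (pochhammer (\<alpha> + 1) n / fact n *
          (pochhammer (- real n) i * pochhammer (real n + \<alpha> + \<beta> + 1) i / (pochhammer (\<alpha> + 1) i * fact i)))
          * of_real (1 - t) ^ i)"
    unfolding pochhammer_of_real sum_distrib_left
    by (intro sum.cong refl) (simp only: of_real_mult of_real_divide of_real_fact mult_ac)
  finally show ?thesis .
qed

text \<open>
  Expanding the polynomial in powers of \<open>1 - t\<close> gives a sum of beta integrals, that is, a terminating
  hypergeometric series at \<open>1\<close>, which the Chu--Vandermonde formula sums to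
  \<open>(k - n + 1)\<^sub>n / (\<alpha> + \<beta> + k + 2)\<^sub>n\<close>. The binomial coefficient is zero for \<open>k < n\<close>: this is the orthogonality
  of the Jacobi polynomial to lower powers.
\<close>

lemma jacobi_weight_moment:
  assumes "\<alpha> > -1" "\<beta> > -1"
  shows "((\<lambda>t. of_real (t powr \<beta> * (1 - t) powr \<alpha>) * jacobi_P n (of_real \<alpha>) (of_real \<beta>) (of_real (2 * t - 1))
             * of_real t ^ k) has_integral
           complex_of_real (real (k choose n) * Beta (\<beta> + 1 + real k) (\<alpha> + 1 + real n))) {0..1}"
proof -
  define d where "d = (\<lambda>i. pochhammer (\<alpha> + 1) n / fact n *
          (pochhammer (- real n) i * pochhammer (real n + \<alpha> + \<beta> + 1) i / (pochhammer (\<alpha> + 1) i * fact i)))"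
  define c where "c = \<alpha> + \<beta> + real k + 2"
  have pos: "pochhammer (\<alpha> + 1) i > 0" "pochhammer c i > 0" for i
    using assms by (auto simp: c_def intro!: pochhammer_pos)
  have "((\<lambda>t. of_real (t powr \<beta> * (1 - t) powr \<alpha>) * of_real t ^ k * of_real (1 - t) ^ i) has_integral
           complex_of_real (Beta (\<beta> + 1 + real k) (\<alpha> + 1 + real i))) {0..1}" for i
    using beta_weight_moment[of "\<beta> + 1" "\<alpha> + 1" k i] assms by simp
  then have int: "((\<lambda>t. \<Sum>i\<le>n. of_real (d i) * (of_real (t powr \<beta> * (1 - t) powr \<alpha>) * of_real t ^ k * of_real (1 - t) ^ i))
         has_integral (\<Sum>i\<le>n. of_real (d i) * complex_of_real (Beta (\<beta> + 1 + real k) (\<alpha> + 1 + real i)))) {0..1}"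
    by (intro has_integral_sum has_integral_mult_right finite_atMost)
  have integrand: "(\<Sum>i\<le>n. of_real (d i) * (of_real (t powr \<beta> * (1 - t) powr \<alpha>) * of_real t ^ k * of_real (1 - t) ^ i)) =
      of_real (t powr \<beta> * (1 - t) powr \<alpha>) * jacobi_P n (of_real \<alpha>) (of_real \<beta>) (of_real (2 * t - 1)) * of_real t ^ k" for t
    unfolding jacobi_P_eq_sum d_def sum_distrib_left sum_distrib_right
    by (intro sum.cong refl) (simp only: mult_ac)
  have cast: "(\<Sum>i\<le>n. of_real (d i) * complex_of_real (Beta (\<beta> + 1 + real k) (\<alpha> + 1 + real i))) =
      of_real (\<Sum>i\<le>n. d i * Beta (\<beta> + 1 + real k) (\<alpha> + 1 + real i))"
    by simp
  have val: "(\<Sum>i\<le>n. d i * Beta (\<beta> + 1 + real k) (\<alpha> + 1 + real i)) =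
      real (k choose n) * Beta (\<beta> + 1 + real k) (\<alpha> + 1 + real n)"
  proof -
    define B where "B = Beta (\<beta> + 1 + real k) (\<alpha> + 1)"
    have Bpos: "B > 0" unfolding B_def Beta_def using assms
      by (auto intro!: divide_pos_pos mult_pos_pos Gamma_real_pos)
    have ratio: "Beta (\<beta> + 1 + real k) (\<alpha> + 1 + real i) = B * pochhammer (\<alpha> + 1) i / pochhammer c i" for i
    proof -
      have "\<alpha> + 1 + (\<beta> + 1 + real k) = c" by (simp add: c_def)
      then have "Beta (\<alpha> + 1 + real i) (\<beta> + 1 + real k) / B = pochhammer (\<alpha> + 1) i / pochhammer c i"
        using Beta_ratio_pochhammer[of "\<alpha> + 1" "\<beta> + 1 + real k" i] assms
        unfolding B_def Beta_commute[of "\<beta> + 1 + real k" "\<alpha> + 1"] by simp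
      then show ?thesis
        using Bpos unfolding Beta_commute[of "\<beta> + 1 + real k" "\<alpha> + 1 + real i"] by (simp add: field_simps)
    qed
    have "(\<Sum>i\<le>n. d i * Beta (\<beta> + 1 + real k) (\<alpha> + 1 + real i)) =
        B * pochhammer (\<alpha> + 1) n / fact n *
          (\<Sum>i\<in>{0..n}. (pochhammer (real n + \<alpha> + \<beta> + 1) i * pochhammer (- real n) i) / (of_nat (fact i) * pochhammer c i))"
      unfolding sum_distrib_left atLeast0AtMost
    proof (intro sum.cong refl)
      fix i
      show "d i * Beta (\<beta> + 1 + real k) (\<alpha> + 1 + real i) = B * pochhammer (\<alpha> + 1) n / fact n *
          ((pochhammer (real n + \<alpha> + \<beta> + 1) i * pochhammer (- real n) i) / (of_nat (fact i) * pochhammer c i))"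
        using pos(1)[of i] pos(2)[of i] unfolding d_def ratio by (simp add: divide_simps)
    qed
    also have "(\<Sum>i\<in>{0..n}. (pochhammer (real n + \<alpha> + \<beta> + 1) i * pochhammer (- real n) i) / (of_nat (fact i) * pochhammer c i))
        = pochhammer (c - (real n + \<alpha> + \<beta> + 1)) n / pochhammer c n"
      using assms by (intro Vandermonde_pochhammer) (auto simp: c_def)
    also have "c - (real n + \<alpha> + \<beta> + 1) = real k - real n + 1" by (simp add: c_def)
    also have "pochhammer (real k - real n + 1) n = fact n * real (k choose n)"
      using gbinomial_pochhammer'[of "real k" n] by (simp add: binomial_gbinomial)
    finally show ?thesis by (simp add: ratio)
  qed
  show ?thesis using int unfolding integrand cast val .
qed

lemma continuous_on_jacobi_P:
  "continuous_on {0..1} (\<lambda>t. jacobi_P n (of_real \<alpha>) (of_real \<beta>) (of_real (2 * t - 1)))"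
  unfolding jacobi_P_eq_sum
  by (intro continuous_on_sum continuous_on_mult_left continuous_on_power continuous_on_of_real
        continuous_on_diff continuous_on_const continuous_on_id)

lemma jacobi_transform_coeff:
  fixes \<alpha> \<beta> :: real and n i :: nat
  assumes "\<alpha> > -1" "\<beta> > -1"
  defines "c \<equiv> \<alpha> + \<beta> + 2 * real n + 2"
  shows "hyp2F1_coeff a b (of_real (\<beta> + 1)) (i + n)
           * of_real (real ((i + n) choose n) * Beta (\<beta> + 1 + real (i + n)) (\<alpha> + 1 + real n)) =
         pochhammer a n * pochhammer b n / (of_real (pochhammer (\<beta> + 1) n) * fact n)
           * of_real (Beta (\<beta> + 1 + real n) (\<alpha> + 1 + real n))
           * hyp2F1_coeff (a + of_nat n) (b + of_nat n) (of_real c) i"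
proof -
  have split: "pochhammer z (i + n) = pochhammer z n * pochhammer (z + of_nat n) i" for z :: "'b :: comm_semiring_1"
    using pochhammer_product'[of z n i] by (simp add: add.commute)
  have pos: "pochhammer (\<beta> + 1) n > 0" "pochhammer (\<beta> + 1 + real n) i > 0" "pochhammer c i > 0"
    using assms by (auto intro!: pochhammer_pos)
  define B where "B = Beta (\<beta> + 1 + real n) (\<alpha> + 1 + real n)"
  have Bpos: "B > 0" unfolding B_def Beta_def using assms
    by (auto intro!: divide_pos_pos mult_pos_pos Gamma_real_pos)
  have "\<beta> + 1 + real n + (\<alpha> + 1 + real n) = c" by (simp add: c_def)
  then have beta: "Beta (\<beta> + 1 + real (i + n)) (\<alpha> + 1 + real n) = B * pochhammer (\<beta> + 1 + real n) i / pochhammer c i"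
    using Beta_ratio_pochhammer[of "\<beta> + 1 + real n" "\<alpha> + 1 + real n" i] assms Bpos
    by (simp add: B_def field_simps)
  have binom: "real ((i + n) choose n) = fact (i + n) / (fact n * fact i)"
    by (simp add: binomial_fact)
  show ?thesis
    unfolding hyp2F1_coeff_def pochhammer_of_real
    unfolding beta binom split B_def[symmetric]
    using pos by (simp add: field_simps)
qed

text \<open>
  On the unit disc this is the moment transform, in which the vanishing moments produce the factor
  \<open>v ^ n\<close>. The identity theorem extends it to the cut plane; that is needed since \<open>4 \<rho> / (1 + \<rho>)\<^sup>2\<close> is not
  confined to the unit disc.
\<close>

lemma jacobi_transform:
  assumes \<alpha>: "\<alpha> > -1" and \<beta>: "\<beta> > -1"
    and \<Phi>: "is_hyp2F1_continuation a b (of_real (\<beta> + 1)) \<Phi>"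
    and \<Psi>: "is_hyp2F1_continuation (a + of_nat n) (b + of_nat n) (of_real (\<alpha> + \<beta> + 2 * real n + 2)) \<Psi>"
    and v: "v \<in> hyp2F1_domain"
  shows "((\<lambda>t. of_real (t powr \<beta> * (1 - t) powr \<alpha>) * jacobi_P n (of_real \<alpha>) (of_real \<beta>) (of_real (2 * t - 1))
             * \<Phi> (v * of_real t)) has_integral
           pochhammer a n * pochhammer b n / (of_real (pochhammer (\<beta> + 1) n) * fact n)
             * of_real (Beta (\<beta> + 1 + real n) (\<alpha> + 1 + real n)) * v ^ n * \<Psi> v) {0..1}"
proof -
  define q where "q = (\<lambda>t. complex_of_real (t powr \<beta> * (1 - t) powr \<alpha>)
                          * jacobi_P n (of_real \<alpha>) (of_real \<beta>) (of_real (2 * t - 1)))"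
  define K where "K = pochhammer a n * pochhammer b n / (complex_of_real (pochhammer (\<beta> + 1) n) * fact n)
             * of_real (Beta (\<beta> + 1 + real n) (\<alpha> + 1 + real n))"
  define V where "V = (\<lambda>v. integral {0..1} (\<lambda>t. q t * \<Phi> (v * of_real t)))"
  have c: "complex_of_real (\<beta> + 1) \<notin> \<int>\<^sub>\<le>\<^sub>0" "complex_of_real (\<alpha> + \<beta> + 2 * real n + 2) \<notin> \<int>\<^sub>\<le>\<^sub>0"
    using \<alpha> \<beta> by (intro of_real_notin_nonpos_Ints; simp)+
  have q: "q absolutely_integrable_on {0..1}"
    unfolding q_def using beta_weight_absolutely_integrable[of "\<beta> + 1" "\<alpha> + 1"] \<alpha> \<beta>
    by (intro absolutely_integrable_mult_continuous continuous_on_jacobi_P) simp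
  have \<Phi>hol: "\<Phi> holomorphic_on hyp2F1_domain"
    and \<Phi>sums: "\<And>z. norm z < 1 \<Longrightarrow> (\<lambda>k. hyp2F1_coeff a b (of_real (\<beta> + 1)) k * z ^ k) sums \<Phi> z"
    using \<Phi> unfolding is_hyp2F1_continuation_iff[OF c(1)] by auto
  have \<Psi>hol: "\<Psi> holomorphic_on hyp2F1_domain"
    and \<Psi>sums: "\<And>z. norm z < 1 \<Longrightarrow> (\<lambda>k. hyp2F1_coeff (a + of_nat n) (b + of_nat n)
                   (of_real (\<alpha> + \<beta> + 2 * real n + 2)) k * z ^ k) sums \<Psi> z"
    using \<Psi> unfolding is_hyp2F1_continuation_iff[OF c(2)] by auto
  have ball: "V z = K * z ^ n * \<Psi> z" if "z \<in> ball 0 1" for z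
  proof -
    have z: "norm z < 1" using that by simp
    define \<tau> where "\<tau> = (\<lambda>k. hyp2F1_coeff a b (of_real (\<beta> + 1)) k
       * of_real (real (k choose n) * Beta (\<beta> + 1 + real k) (\<alpha> + 1 + real n)) * z ^ k)"
    have "integral {0..1} (\<lambda>t. q t * of_real t ^ k) =
            of_real (real (k choose n) * Beta (\<beta> + 1 + real k) (\<alpha> + 1 + real n))" for k
      unfolding q_def by (intro integral_unique jacobi_weight_moment \<alpha> \<beta>)
    then have "\<tau> sums V z"
      using moment_transform_sums[OF q \<Phi>hol \<Phi>sums z] unfolding V_def \<tau>_def by simp
    then have shifted: "(\<lambda>i. \<tau> (i + n)) sums V z"
      by (subst sums_zero_iff_shift) (auto simp: \<tau>_def binomial_eq_0)
    have shift: "\<tau> (i + n) = K * z ^ n * (hyp2F1_coeff (a + of_nat n) (b + of_nat n)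
                   (of_real (\<alpha> + \<beta> + 2 * real n + 2)) i * z ^ i)" for i
      unfolding \<tau>_def K_def jacobi_transform_coeff[OF \<alpha> \<beta>] by (simp add: power_add mult_ac)
    have "(\<lambda>i. \<tau> (i + n)) sums (K * z ^ n * \<Psi> z)"
      unfolding shift by (rule sums_mult[OF \<Psi>sums[OF z]])
    with shifted show ?thesis by (rule sums_unique2)
  qed
  have "V v = K * v ^ n * \<Psi> v"
  proof (rule analytic_continuation_open[where f = V and g = "\<lambda>v. K * v ^ n * \<Psi> v" and s = "ball 0 1" and s' = hyp2F1_domain])
    show "V holomorphic_on hyp2F1_domain"
      unfolding V_def by (rule moment_transform_holomorphic[OF q \<Phi>hol])
    show "(\<lambda>v. K * v ^ n * \<Psi> v) holomorphic_on hyp2F1_domain"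
      by (intro holomorphic_intros \<Psi>hol)
  qed (use ball ball_subset_hyp2F1_domain v in auto)
  moreover have "((\<lambda>t. q t * \<Phi> (v * of_real t)) has_integral V v) {0..1}"
    unfolding V_def using moment_transform_integrable[OF q \<Phi>hol v]
    by (intro integrable_integral) (simp add: absolutely_integrable_on_def)
  ultimately show ?thesis by (simp add: q_def K_def)
qed

section \<open>Principal branches along the segment of integration\<close>

lemma square_real_imp_real:
  fixes w :: complex
  assumes "Re w > 0" "Im (w\<^sup>2) = 0"
  shows "Im w = 0"
proof -
  have "2 * Re w * Im w = 0" using assms(2) by (simp only: Im_power2)
  with assms(1) show ?thesis by simp
qed

lemma Re_csqrt_pos:
  assumes "z \<notin> \<real>\<^sub>\<le>\<^sub>0"
  shows "Re (csqrt z) > 0"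
proof (rule ccontr)
  assume "\<not> Re (csqrt z) > 0"
  then have "Re (csqrt z) = 0" using Re_csqrt[of z] by linarith
  then have "Re ((csqrt z)\<^sup>2) \<le> 0" "Im ((csqrt z)\<^sup>2) = 0"
    by (simp_all only: Re_power2 Im_power2) simp_all
  with assms show False by (simp add: complex_nonpos_Reals_iff)
qed

lemma Ln_divide_Re_pos:
  assumes "Re a > 0" "Re b > 0"
  shows "Ln (a / b) = Ln a - Ln b"
proof (rule Ln_unique)
  have "a \<noteq> 0" "b \<noteq> 0" using assms by auto
  then show "exp (Ln a - Ln b) = a / b" by (simp add: exp_diff)
  show "- pi < Im (Ln a - Ln b)" "Im (Ln a - Ln b) \<le> pi"
    using Re_Ln_pos_lt_imp[OF assms(1)] Re_Ln_pos_lt_imp[OF assms(2)] by auto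
qed

lemma Re_one_divide_pos: "Re w > 0 \<Longrightarrow> Re (1 / w) > 0"
  by (auto simp: Re_divide intro!: divide_pos_pos add_pos_nonneg)

lemma Re_Cayley_pos:
  assumes "norm \<rho> < 1"
  shows "Re ((1 + \<rho>) / (1 - \<rho>)) > 0"
proof -
  have "\<rho> \<noteq> 1" using assms by auto
  have "(norm \<rho>)\<^sup>2 < 1" using assms by (simp add: abs_square_less_1)
  then have "Re ((1 + \<rho>) * cnj (1 - \<rho>)) > 0"
    by (simp add: cmod_power2 algebra_simps) (simp add: power2_eq_square)
  then show ?thesis
    using \<open>\<rho> \<noteq> 1\<close> by (simp only: Re_complex_div_gt_0)
qed

text \<open>
  Four times a rotated Koebe function: it maps the unit disc onto the plane cut along \<open>[1, \<infinity>)\<close>.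
\<close>

definition koebe :: "complex \<Rightarrow> complex" where
  "koebe \<rho> = 4 * \<rho> / (1 + \<rho>)\<^sup>2"

text \<open>
  In terms of \<open>t = (1 + x) / 2\<close> this is the argument \<open>(1 + \<rho>) / R\<close> of the Legendre function under the
  integral, see \<open>csqrt_generating_radicand\<close>. In this form its real part is visibly positive.
\<close>

definition legendre_arg :: "complex \<Rightarrow> real \<Rightarrow> complex" where
  "legendre_arg \<rho> t = 1 / csqrt (1 - koebe \<rho> * of_real t)"

text \<open>
  The Cayley transform \<open>\<omega> = (1 + \<rho>) / (1 - \<rho>)\<close> maps the disc to the right half-plane and turns the Koebe
  function into \<open>1 - \<omega>\<^sup>-\<^sup>2\<close>.
\<close>

lemma koebe_eq:
  assumes "norm (\<rho> :: complex) < 1"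
  shows "koebe \<rho> = 1 - (1 / ((1 + \<rho>) / (1 - \<rho>)))\<^sup>2"
proof -
  have "1 + \<rho> \<noteq> 0" using assms by (auto simp: add_eq_0_iff)
  then show ?thesis by (simp add: koebe_def power_divide diff_divide_eq_iff) (simp add: power2_eq_square algebra_simps)
qed

lemma koebe_in_hyp2F1_domain:
  assumes "norm \<rho> < 1"
  shows "koebe \<rho> \<in> hyp2F1_domain"
  unfolding koebe_eq[OF assms] by (intro quadratic_arg_in_domain Re_Cayley_pos assms)

lemma one_minus_hyp2F1_domain: "s \<in> hyp2F1_domain \<Longrightarrow> 1 - s \<notin> \<real>\<^sub>\<le>\<^sub>0"
  by (auto simp: hyp2F1_domain_iff complex_nonpos_Reals_iff)

context
  fixes \<rho> :: complex
  assumes \<rho>: "norm \<rho> < 1"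
begin

lemma scaled_koebe_notin_nonpos_Reals:
  assumes "0 \<le> t" "t \<le> 1"
  shows "1 - koebe \<rho> * of_real t \<notin> \<real>\<^sub>\<le>\<^sub>0"
  by (intro one_minus_hyp2F1_domain hyp2F1_domain_scale koebe_in_hyp2F1_domain \<rho> assms)

lemma Re_one_plus_pos: "Re (1 + \<rho>) > 0"
  using \<rho> complex_Re_le_cmod[of "- \<rho>"] by simp

text \<open>
  The imaginary part vanishes only for real \<open>\<rho>\<close>, where the value is at least \<open>(1 - |\<rho>|)\<^sup>2\<close>, and for
  \<open>x = Re \<rho>\<close>, where the value is \<open>1 - |\<rho>|\<^sup>2\<close>.
\<close>

lemma generating_radicand_notin_nonpos_Reals:
  assumes "-1 \<le> x" "x \<le> 1"
  shows "1 + \<rho>\<^sup>2 - 2 * \<rho> * of_real x \<notin> \<real>\<^sub>\<le>\<^sub>0"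
proof
  assume "1 + \<rho>\<^sup>2 - 2 * \<rho> * of_real x \<in> \<real>\<^sub>\<le>\<^sub>0"
  then have im: "2 * Im \<rho> * (Re \<rho> - x) = 0"
    and re: "1 + (Re \<rho>)\<^sup>2 - (Im \<rho>)\<^sup>2 - 2 * Re \<rho> * x \<le> 0"
    by (auto simp: complex_nonpos_Reals_iff Re_power2 Im_power2 algebra_simps)
  have n: "(Re \<rho>)\<^sup>2 + (Im \<rho>)\<^sup>2 < 1"
    using \<rho> by (metis abs_norm_cancel abs_square_less_1 cmod_power2)
  show False
  proof (cases "Im \<rho> = 0")
    case True
    have "\<bar>Re \<rho> * x\<bar> \<le> \<bar>Re \<rho>\<bar> * 1"
      unfolding abs_mult using assms by (intro mult_left_mono) auto
    then have "Re \<rho> * x \<le> \<bar>Re \<rho>\<bar>" by linarith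
    moreover have "(1 - \<bar>Re \<rho>\<bar>)\<^sup>2 > 0"
      using n True by (auto simp: abs_square_less_1)
    then have "1 + (Re \<rho>)\<^sup>2 - 2 * \<bar>Re \<rho>\<bar> > 0" by (simp add: power2_eq_square algebra_simps)
    ultimately show False using re True by simp
  next
    case False
    then have "x = Re \<rho>" using im by simp
    then show False using re n by (simp add: power2_eq_square)
  qed
qed

text \<open>
  Both sides have the same square. The right-hand side is the principal root because its real part
  is positive at \<open>t = 0\<close> and cannot vanish on the way, as its square avoids the negative axis.
\<close>

lemma csqrt_generating_radicand:
  assumes "0 \<le> t" "t \<le> 1"
  shows "csqrt (1 + \<rho>\<^sup>2 - 2 * \<rho> * of_real (2 * t - 1)) = (1 + \<rho>) * csqrt (1 - koebe \<rho> * of_real t)"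
proof -
  define u where "u = (\<lambda>t. (1 + \<rho>) * csqrt (1 - koebe \<rho> * complex_of_real t))"
  have nz: "1 + \<rho> \<noteq> 0" using Re_one_plus_pos by (auto simp: complex_eq_iff)
  have sq: "(u t)\<^sup>2 = 1 + \<rho>\<^sup>2 - 2 * \<rho> * of_real (2 * t - 1)" for t
  proof -
    have "(u t)\<^sup>2 = (1 + \<rho>)\<^sup>2 * (1 - koebe \<rho> * of_real t)" by (simp add: u_def power_mult_distrib)
    also have "\<dots> = (1 + \<rho>)\<^sup>2 - (1 + \<rho>)\<^sup>2 * koebe \<rho> * of_real t" by (simp add: algebra_simps)
    also have "(1 + \<rho>)\<^sup>2 * koebe \<rho> = 4 * \<rho>" using nz by (simp add: koebe_def)
    finally show ?thesis by (simp add: power2_eq_square algebra_simps)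
  qed
  have ne: "Re (u t) \<noteq> 0" if "0 \<le> t" "t \<le> 1" for t
  proof
    assume "Re (u t) = 0"
    then have "Re ((u t)\<^sup>2) \<le> 0" "Im ((u t)\<^sup>2) = 0"
      by (simp_all only: Re_power2 Im_power2) simp_all
    then have "(u t)\<^sup>2 \<in> \<real>\<^sub>\<le>\<^sub>0" by (simp add: complex_nonpos_Reals_iff)
    then show False
      using generating_radicand_notin_nonpos_Reals[of "2 * t - 1"] that unfolding sq by simp
  qed
  have "continuous_on {0..1} (\<lambda>t. Re (u t))"
    unfolding u_def using scaled_koebe_notin_nonpos_Reals
    by (intro continuous_intros continuous_on_compose2[OF continuous_on_csqrt]) auto
  then have cont: "continuous_on {0..t} (\<lambda>t. Re (u t))"
    by (rule continuous_on_subset) (use assms in auto)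
  have "Re (u 0) > 0" using Re_one_plus_pos by (simp add: u_def)
  have "Re (u t) > 0"
  proof (rule ccontr)
    assume "\<not> Re (u t) > 0"
    then obtain t' where "0 \<le> t'" "t' \<le> t" "Re (u t') = 0"
      using IVT2'[of "\<lambda>t. Re (u t)" t 0 0] \<open>Re (u 0) > 0\<close> assms cont by auto
    with ne[of t'] assms show False by auto
  qed
  then have "csqrt ((u t)\<^sup>2) = u t" by (intro csqrt_square) auto
  then show ?thesis unfolding sq by (simp add: u_def)
qed

lemma Re_legendre_arg_pos:
  assumes "0 \<le> t" "t \<le> 1"
  shows "Re (legendre_arg \<rho> t) > 0"
  unfolding legendre_arg_def by (intro Re_one_divide_pos Re_csqrt_pos scaled_koebe_notin_nonpos_Reals assms)

lemma legendre_arg_quadratic: "1 - (1 / legendre_arg \<rho> t)\<^sup>2 = koebe \<rho> * of_real t"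
  by (simp add: legendre_arg_def)

context
  assumes \<rho>_slit: "\<rho> \<notin> \<real>\<^sub>\<le>\<^sub>0"
begin

lemma koebe_notin_nonpos_Reals: "koebe \<rho> \<notin> \<real>\<^sub>\<le>\<^sub>0"
proof
  define w where "w = 1 / ((1 + \<rho>) / (1 - \<rho>))"
  have "\<rho> \<noteq> 1" using \<rho> by auto
  have "1 + \<rho> \<noteq> 0" using Re_one_plus_pos by (auto simp: complex_eq_iff)
  assume "koebe \<rho> \<in> \<real>\<^sub>\<le>\<^sub>0"
  moreover have kw: "koebe \<rho> = 1 - w\<^sup>2" unfolding w_def by (rule koebe_eq[OF \<rho>])
  ultimately have w2: "Im (w\<^sup>2) = 0" "Re (w\<^sup>2) \<ge> 1" by (auto simp: complex_nonpos_Reals_iff)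
  have "Re w > 0" unfolding w_def by (intro Re_one_divide_pos Re_Cayley_pos \<rho>)
  with w2(1) have im: "Im w = 0" by (rule square_real_imp_real[rotated])
  define y where "y = Re w"
  have wy: "w = of_real y" using im by (simp add: y_def complex_eq_iff)
  have "y\<^sup>2 \<ge> 1" using w2(2) unfolding wy by (simp flip: of_real_power)
  moreover have "y > 0" using \<open>Re w > 0\<close> by (simp add: y_def)
  ultimately have "y \<ge> 1" using abs_square_less_1[of y] by linarith
  have "w * (1 + \<rho>) = 1 - \<rho>" using \<open>1 + \<rho> \<noteq> 0\<close> by (simp add: w_def)
  then have "\<rho> * of_real (1 + y) = of_real (1 - y)" unfolding wy by (simp add: algebra_simps)
  moreover have "complex_of_real (1 + y) \<noteq> 0" using \<open>y \<ge> 1\<close> unfolding of_real_eq_0_iff by linarith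
  ultimately have "\<rho> = of_real (1 - y) / of_real (1 + y)" by (metis nonzero_eq_divide_eq)
  then have "\<rho> = of_real ((1 - y) / (1 + y))" by (simp only: of_real_divide)
  moreover have "(1 - y) / (1 + y) \<le> 0" using \<open>y \<ge> 1\<close> by (intro divide_nonpos_pos) auto
  ultimately have "\<rho> \<in> \<real>\<^sub>\<le>\<^sub>0" by (simp only: nonpos_Reals_of_real_iff)
  with \<rho>_slit show False by simp
qed

lemma legendre_arg_neq_1:
  assumes "0 < t"
  shows "legendre_arg \<rho> t \<noteq> 1"
proof
  assume "legendre_arg \<rho> t = 1"
  then have "koebe \<rho> * of_real t = 0" using legendre_arg_quadratic[of t] by simp
  then show False using koebe_notin_nonpos_Reals assms by auto
qed

text \<open>
  A nonpositive value would put \<open>\<zeta> = legendre_arg \<rho> t\<close> into \<open>(0, 1]\<close>, so that \<open>koebe \<rho> * t = 1 - \<zeta>\<^sup>-\<^sup>2 \<le> 0\<close>; but the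
  Koebe function is nonpositive only on the excluded slit.
\<close>

lemma legendre_arg_quotient_notin_nonpos_Reals:
  assumes t: "0 < t" "t \<le> 1"
  shows "(legendre_arg \<rho> t + 1) / (legendre_arg \<rho> t - 1) \<notin> \<real>\<^sub>\<le>\<^sub>0"
proof
  assume "(legendre_arg \<rho> t + 1) / (legendre_arg \<rho> t - 1) \<in> \<real>\<^sub>\<le>\<^sub>0"
  then obtain y where y: "y \<le> 0" "(legendre_arg \<rho> t + 1) / (legendre_arg \<rho> t - 1) = of_real y" by (rule nonpos_Reals_cases)
  have "legendre_arg \<rho> t + 1 = of_real y * (legendre_arg \<rho> t - 1)" using y(2) legendre_arg_neq_1[OF t(1)] by (simp add: divide_eq_eq)
  then have "legendre_arg \<rho> t * of_real (1 - y) = of_real (- 1 - y)" by (simp add: algebra_simps)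
  moreover have "complex_of_real (1 - y) \<noteq> 0" using y(1) unfolding of_real_eq_0_iff by linarith
  ultimately have "legendre_arg \<rho> t = of_real (- 1 - y) / of_real (1 - y)" by (metis nonzero_eq_divide_eq)
  then have Zt: "legendre_arg \<rho> t = of_real ((- 1 - y) / (1 - y))" by (simp only: of_real_divide)
  define z where "z = (- 1 - y) / (1 - y)"
  have "z > 0" using Re_legendre_arg_pos[of t] t Zt by (simp add: z_def)
  moreover have "z \<le> 1" using y(1) by (simp add: z_def divide_le_eq)
  ultimately have "(1 / z)\<^sup>2 \<ge> 1" by (simp add: power_divide power_le_one)
  have "koebe \<rho> * of_real t = of_real (1 - (1 / z)\<^sup>2)"
    using legendre_arg_quadratic[of t] unfolding Zt z_def[symmetric] by simp
  moreover have "complex_of_real t \<noteq> 0" using t by simp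
  ultimately have "koebe \<rho> = of_real (1 - (1 / z)\<^sup>2) / of_real t" by (metis nonzero_eq_divide_eq)
  then have "koebe \<rho> = of_real ((1 - (1 / z)\<^sup>2) / t)" by (simp only: of_real_divide)
  moreover have "(1 - (1 / z)\<^sup>2) / t \<le> 0" using \<open>(1 / z)\<^sup>2 \<ge> 1\<close> t by (intro divide_nonpos_pos) auto
  ultimately have "koebe \<rho> \<in> \<real>\<^sub>\<le>\<^sub>0" by (simp only: nonpos_Reals_of_real_iff)
  then show False using koebe_notin_nonpos_Reals by simp
qed

text \<open>
  The logarithmic form of \<open>(\<zeta>\<^sup>2 - 1) / (4 \<zeta>\<^sup>2) = \<rho> t / (1 + \<rho>)\<^sup>2\<close>, with the left side factored as the Legendre
  function requires. The difference of the two sides is a multiple of \<open>2 \<pi> \<i>\<close> that depends continuously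
  on \<open>t\<close>, hence is constant. At \<open>t = 1\<close> the root \<open>R\<close> is \<open>1 - \<rho>\<close>, and the identity reduces to rules for
  logarithms in the right half-plane.
\<close>

lemma Ln_branch_identity:
  assumes t: "0 < t" "t \<le> 1"
  shows "2 * Ln ((1 + legendre_arg \<rho> t) / 2) - 2 * Ln (legendre_arg \<rho> t) - Ln ((legendre_arg \<rho> t + 1) / (legendre_arg \<rho> t - 1)) =
           Ln \<rho> + of_real (ln t) - 2 * Ln (1 + \<rho>)"
proof -
  define d where "d = (\<lambda>t. 2 * Ln ((1 + legendre_arg \<rho> t) / 2) - 2 * Ln (legendre_arg \<rho> t) - Ln ((legendre_arg \<rho> t + 1) / (legendre_arg \<rho> t - 1))
                             - (Ln \<rho> + of_real (ln t) - 2 * Ln (1 + \<rho>)))"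
  have "1 + \<rho> \<noteq> 0" using Re_one_plus_pos by (auto simp: complex_eq_iff)
  with \<rho> \<rho>_slit have \<rho>0: "\<rho> \<noteq> 0" "1 + \<rho> \<noteq> 0" "\<rho> \<noteq> 1" by auto
  have Z0: "legendre_arg \<rho> t \<noteq> 0" "1 + legendre_arg \<rho> t \<noteq> 0" "Re (1 + legendre_arg \<rho> t) > 0" if "0 < t" "t \<le> 1" for t
    using Re_legendre_arg_pos[of t] that by (auto simp: complex_eq_iff)
  have exp_d: "exp (d t) = 1" if "0 < t" "t \<le> 1" for t
  proof -
    have dbl: "exp (2 * Ln a) = a\<^sup>2" if "a \<noteq> 0" for a
      using that by (simp add: exp_double)
    have ln: "exp (of_real (ln t)) = complex_of_real t" using \<open>0 < t\<close> by (simp only: exp_of_real exp_ln)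
    have "exp (d t) = (((1 + legendre_arg \<rho> t) / 2)\<^sup>2 / (legendre_arg \<rho> t)\<^sup>2 / ((legendre_arg \<rho> t + 1) / (legendre_arg \<rho> t - 1))) / (\<rho> * of_real t / (1 + \<rho>)\<^sup>2)"
      unfolding d_def exp_diff exp_add using \<rho>0 Z0[OF that] legendre_arg_neq_1[OF that(1)]
      by (simp add: dbl ln add.commute)
    also have "((1 + legendre_arg \<rho> t) / 2)\<^sup>2 / (legendre_arg \<rho> t)\<^sup>2 / ((legendre_arg \<rho> t + 1) / (legendre_arg \<rho> t - 1)) = (1 - (1 / legendre_arg \<rho> t)\<^sup>2) / 4"
    proof -
      have "((1 + legendre_arg \<rho> t) / 2)\<^sup>2 / (legendre_arg \<rho> t)\<^sup>2 / ((legendre_arg \<rho> t + 1) / (legendre_arg \<rho> t - 1)) =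
              ((1 + legendre_arg \<rho> t) / (legendre_arg \<rho> t + 1)) * ((1 + legendre_arg \<rho> t) * (legendre_arg \<rho> t - 1) / (4 * (legendre_arg \<rho> t)\<^sup>2))"
        by (simp add: power2_eq_square mult_ac)
      also have "(1 + legendre_arg \<rho> t) / (legendre_arg \<rho> t + 1) = 1" using Z0(2)[OF that] by (simp add: add.commute)
      finally show ?thesis using Z0(1)[OF that] by (simp add: field_simps power2_eq_square)
    qed
    also have "\<dots> = \<rho> * of_real t / (1 + \<rho>)\<^sup>2"
      unfolding legendre_arg_quadratic by (simp add: koebe_def)
    also have "\<rho> * of_real t / (1 + \<rho>)\<^sup>2 / (\<rho> * of_real t / (1 + \<rho>)\<^sup>2) = 1"
      using \<rho>0 that by simp
    finally show ?thesis .
  qed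
  have "d constant_on {0<..1}"
  proof (rule continuous_discrete_range_constant)
    have cont_arg: "continuous_on {0<..1} (legendre_arg \<rho>)"
      unfolding legendre_arg_def[abs_def]
    proof (intro continuous_intros continuous_on_compose2[OF continuous_on_csqrt] ballI)
      show "(\<lambda>t. 1 - koebe \<rho> * complex_of_real t) ` {0<..1} \<subseteq> - \<real>\<^sub>\<le>\<^sub>0"
        using scaled_koebe_notin_nonpos_Reals by auto
      show "csqrt (1 - koebe \<rho> * of_real t) \<noteq> 0" if "t \<in> {0<..1}" for t
      proof -
        have "Re (csqrt (1 - koebe \<rho> * of_real t)) > 0"
          using that by (intro Re_csqrt_pos scaled_koebe_notin_nonpos_Reals) auto
        then show ?thesis by (metis less_irrefl zero_complex.sel(1))
      qed
    qed
    have pos: "Re (legendre_arg \<rho> t) > 0" "legendre_arg \<rho> t - 1 \<noteq> 0" if "t \<in> {0<..1}" for t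
      using that Re_legendre_arg_pos[of t] legendre_arg_neq_1[of t] by auto
    have contLn: "continuous_on {0<..1} (\<lambda>t. Ln (h t))"
      if "continuous_on {0<..1} h" "\<And>t. t \<in> {0<..1} \<Longrightarrow> h t \<notin> \<real>\<^sub>\<le>\<^sub>0" for h :: "real \<Rightarrow> complex"
      by (rule continuous_on_compose2[OF continuous_on_Ln[of "- \<real>\<^sub>\<le>\<^sub>0"] that(1)]) (use that(2) in auto)
    have "continuous_on {0<..1} (\<lambda>t. Ln ((1 + legendre_arg \<rho> t) / 2))"
      using pos(1) by (intro contLn continuous_intros cont_arg) (force simp: complex_nonpos_Reals_iff)+
    moreover have "continuous_on {0<..1} (\<lambda>t. Ln (legendre_arg \<rho> t))"
      using pos(1) by (intro contLn cont_arg) (force simp: complex_nonpos_Reals_iff)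
    moreover have "continuous_on {0<..1} (\<lambda>t. Ln ((legendre_arg \<rho> t + 1) / (legendre_arg \<rho> t - 1)))"
    proof (rule contLn)
      show "continuous_on {0<..1} (\<lambda>t. (legendre_arg \<rho> t + 1) / (legendre_arg \<rho> t - 1))"
        using pos(2) by (intro continuous_intros cont_arg) auto
      show "(legendre_arg \<rho> t + 1) / (legendre_arg \<rho> t - 1) \<notin> \<real>\<^sub>\<le>\<^sub>0" if "t \<in> {0<..1}" for t
        using that by (intro legendre_arg_quotient_notin_nonpos_Reals) auto
    qed
    moreover have "continuous_on {0<..1} (\<lambda>t. complex_of_real (ln t))"
      by (intro continuous_on_of_real continuous_on_ln continuous_on_id) auto
    ultimately show "continuous_on {0<..1} d"
      unfolding d_def
      by (intro continuous_on_diff continuous_on_add continuous_on_mult_left continuous_on_const)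
    show "\<exists>e>0. \<forall>y. y \<in> {0<..1} \<and> d y \<noteq> d x \<longrightarrow> e \<le> norm (d y - d x)" if "x \<in> {0<..1}" for x
    \<comment> \<open>Distinct values differ by a nonzero multiple of \<open>2 \<pi> \<i>\<close>.\<close>
    proof (intro exI[of _ "2 * pi"] conjI allI impI)
      fix y assume y: "y \<in> {0<..1} \<and> d y \<noteq> d x"
      then have "exp (d y) = exp (d x)" using exp_d that by simp
      show "2 * pi \<le> norm (d y - d x)"
      proof (rule ccontr)
        assume "\<not> 2 * pi \<le> norm (d y - d x)"
        then have "\<bar>Im (d y) - Im (d x)\<bar> < 2 * pi"
          using abs_Im_le_cmod[of "d y - d x"] by simp
        with \<open>exp (d y) = exp (d x)\<close> have "d y = d x" by (rule exp_complex_eqI[rotated])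
        with y show False by simp
      qed
    qed simp
  qed simp
  then have "d t = d 1" using t unfolding constant_on_def by auto
  also have "d 1 = 0"
  proof -
    have Re_minus: "Re (1 - \<rho>) > 0" using \<rho> complex_Re_le_cmod[of \<rho>] by simp
    have Z1: "legendre_arg \<rho> 1 = (1 + \<rho>) / (1 - \<rho>)"
    proof -
      have "csqrt ((1 - \<rho>)\<^sup>2) = 1 - \<rho>" using Re_minus by (intro csqrt_square) simp
      moreover have "(1 - \<rho>)\<^sup>2 = 1 + \<rho>\<^sup>2 - 2 * \<rho> * of_real (2 * 1 - 1)"
        by (simp add: power2_eq_square algebra_simps)
      ultimately have "1 - \<rho> = (1 + \<rho>) * csqrt (1 - koebe \<rho> * of_real 1)"
        using csqrt_generating_radicand[of 1] by simp
      then show ?thesis using \<rho>0 by (simp add: legendre_arg_def)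
    qed
    have args: "(1 + legendre_arg \<rho> 1) / 2 = 1 / (1 - \<rho>)" "(legendre_arg \<rho> 1 + 1) / (legendre_arg \<rho> 1 - 1) = 1 / \<rho>"
      using \<rho>0 by (simp_all add: Z1 field_simps)
    have "Ln ((1 + legendre_arg \<rho> 1) / 2) = - Ln (1 - \<rho>)"
      unfolding args using Ln_divide_Re_pos[of 1, OF _ Re_minus] by simp
    moreover have "Ln (legendre_arg \<rho> 1) = Ln (1 + \<rho>) - Ln (1 - \<rho>)"
      unfolding Z1 by (rule Ln_divide_Re_pos[OF Re_one_plus_pos Re_minus])
    moreover have "Ln ((legendre_arg \<rho> 1 + 1) / (legendre_arg \<rho> 1 - 1)) = - Ln \<rho>"
      unfolding args using Ln_inverse[OF \<rho>_slit] by (simp add: divide_inverse)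
    ultimately have "d 1 = 2 * (- Ln (1 - \<rho>)) - 2 * (Ln (1 + \<rho>) - Ln (1 - \<rho>)) - (- Ln \<rho>)
                       - (Ln \<rho> + of_real (ln 1) - 2 * Ln (1 + \<rho>))"
      unfolding d_def by (simp only:)
    then show ?thesis by simp
  qed
  finally show ?thesis by (simp add: d_def)
qed

end
end

section \<open>The Legendre functions on both sides\<close>

text \<open>
  After the quadratic transformation the quantities \<open>1 + \<zeta>\<close>, \<open>\<zeta>\<close> and \<open>(\<zeta> + 1) / (\<zeta> - 1)\<close> occur with exponents
  \<open>\<beta>\<close>, \<open>-\<beta>\<close> and \<open>-\<beta> / 2\<close>, once \<open>R = (1 + \<rho>) / \<zeta>\<close> is inserted. This is exactly \<open>\<beta> / 2\<close> times the
  combination of logarithms in \<open>Ln_branch_identity\<close>.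
\<close>

lemma legendre_P_left:
  fixes \<gamma> \<beta> t :: real
  assumes \<rho>: "norm \<rho> < 1" "\<rho> \<notin> \<real>\<^sub>\<le>\<^sub>0" and t: "0 < t" "t < 1"
    and \<gamma>: "\<gamma> > -1" and \<beta>: "\<beta> > -1"
  defines "A \<equiv> complex_of_real \<gamma> + of_real \<beta> + 1"
  assumes \<Phi>: "is_hyp2F1_continuation (A / 2) ((A + 1) / 2) (of_real (\<beta> + 1)) \<Phi>"
  shows "legendre_P (of_real \<gamma>) (- of_real \<beta>) (legendre_arg \<rho> t) / ((1 + \<rho>) / legendre_arg \<rho> t) powr (of_real \<gamma> + 1) =
           \<rho> powr (of_real \<beta> / 2) * of_real (t powr (\<beta> / 2)) * (1 + \<rho>) powr (- A)
             * \<Phi> (koebe \<rho> * of_real t) / of_real (Gamma (\<beta> + 1))"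
proof -
  define z where "z = legendre_arg \<rho> t"
  have z: "Re z > 0" "z \<noteq> 0" using Re_legendre_arg_pos[OF \<rho>(1), of t] t by (auto simp: z_def)
  have z1: "(1 + z) / 2 \<noteq> 0" "(z + 1) / (z - 1) \<noteq> 0"
  proof -
    have "1 + z \<noteq> 0" using z(1) by (auto simp: complex_eq_iff)
    moreover have "z \<noteq> 1" unfolding z_def by (rule legendre_arg_neq_1[OF \<rho> t(1)])
    ultimately show "(1 + z) / 2 \<noteq> 0" "(z + 1) / (z - 1) \<noteq> 0" by (simp_all add: add.commute)
  qed
  have \<rho>1: "Re (1 + \<rho>) > 0" "1 + \<rho> \<noteq> 0" "\<rho> \<noteq> 0"
    using Re_one_plus_pos[OF \<rho>(1)] \<rho>(2) by force+
  have c: "1 + complex_of_real \<beta> \<notin> \<int>\<^sub>\<le>\<^sub>0" "complex_of_real (\<beta> + 1) = 1 + of_real \<beta>"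
    using of_real_notin_nonpos_Ints[of "1 + \<beta>"] \<beta> by simp_all
  have "is_hyp2F1_continuation (- of_real \<gamma>) (of_real \<gamma> + 1) (of_real (\<beta> + 1))
          (hyp2F1 (- of_real \<gamma>) (of_real \<gamma> + 1) (of_real (\<beta> + 1)))"
    using \<gamma> \<beta> by (intro hyp2F1_is_continuation) auto
  from quadratic_transformation[OF c(1) this[unfolded c(2)] \<Phi>[unfolded A_def c(2)] z(1)]
  have hyp: "hyp2F1 (- of_real \<gamma>) (of_real \<gamma> + 1) (1 + of_real \<beta>) ((1 - z) / 2) =
      ((1 + z) / 2) powr of_real \<beta> * z powr (- A) * \<Phi> (koebe \<rho> * of_real t)"
    by (simp add: A_def z_def legendre_arg_quadratic[OF \<rho>(1)])
  have "Ln ((1 + \<rho>) / z) = Ln (1 + \<rho>) - Ln z"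
    by (rule Ln_divide_Re_pos[OF \<rho>1(1) z(1)])
  moreover have "2 * Ln ((1 + z) / 2) - 2 * Ln z - Ln ((z + 1) / (z - 1)) =
           Ln \<rho> + of_real (ln t) - 2 * Ln (1 + \<rho>)"
    unfolding z_def using t by (intro Ln_branch_identity \<rho>) auto
  then have "Ln ((z + 1) / (z - 1)) = 2 * Ln ((1 + z) / 2) - 2 * Ln z - (Ln \<rho> + of_real (ln t) - 2 * Ln (1 + \<rho>))"
    by (simp add: algebra_simps)
  ultimately have logs: "- of_real \<beta> / 2 * Ln ((z + 1) / (z - 1)) + (of_real \<beta> * Ln ((1 + z) / 2) + - A * Ln z)
      - (of_real \<gamma> + 1) * Ln ((1 + \<rho>) / z) =
      of_real \<beta> / 2 * Ln \<rho> + of_real (\<beta> / 2 * ln t) + - A * Ln (1 + \<rho>)"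
    by (simp only:) (simp add: A_def field_simps)
  have "((z + 1) / (z - 1)) powr (- of_real \<beta> / 2) * (((1 + z) / 2) powr of_real \<beta> * z powr (- A))
           / ((1 + \<rho>) / z) powr (of_real \<gamma> + 1)
      = exp (- of_real \<beta> / 2 * Ln ((z + 1) / (z - 1)) + (of_real \<beta> * Ln ((1 + z) / 2) + - A * Ln z)
      - (of_real \<gamma> + 1) * Ln ((1 + \<rho>) / z))"
    unfolding exp_add exp_diff using z1 z \<rho>1 by (simp add: powr_def)
  also have "\<dots> = \<rho> powr (of_real \<beta> / 2) * of_real (t powr (\<beta> / 2)) * (1 + \<rho>) powr (- A)"
    unfolding logs exp_add exp_of_real using \<rho>1 t by (simp add: powr_def)
  finally have powers: "((z + 1) / (z - 1)) powr (- of_real \<beta> / 2) * (((1 + z) / 2) powr of_real \<beta> * z powr (- A))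
           / ((1 + \<rho>) / z) powr (of_real \<gamma> + 1) =
      \<rho> powr (of_real \<beta> / 2) * of_real (t powr (\<beta> / 2)) * (1 + \<rho>) powr (- A)" .
  have Gam: "Gamma (1 + complex_of_real \<beta>) = of_real (Gamma (\<beta> + 1))"
    using Gamma_complex_of_real[of "1 + \<beta>"] by (simp add: add.commute)
  have "legendre_P (of_real \<gamma>) (- of_real \<beta>) z / ((1 + \<rho>) / z) powr (of_real \<gamma> + 1) =
     (((z + 1) / (z - 1)) powr (- of_real \<beta> / 2) * (((1 + z) / 2) powr of_real \<beta> * z powr (- A))
           / ((1 + \<rho>) / z) powr (of_real \<gamma> + 1)) * \<Phi> (koebe \<rho> * of_real t) / of_real (Gamma (\<beta> + 1))"
    unfolding legendre_P_def diff_minus_eq_add hyp Gam by (simp add: mult_ac)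
  from this[unfolded powers] show ?thesis unfolding z_def .
qed

text \<open>
  The degree \<open>-m\<close> is interchangeable with \<open>m - 1\<close>, by the symmetry of the series in its first two
  parameters. Taking \<open>\<gamma> = m - 1\<close> in the quadratic transformation makes the transformed parameters
  \<open>B / 2\<close> and \<open>(B + 1) / 2\<close> with \<open>B = c - 1 + m\<close>, which agree with the outcome of \<open>jacobi_transform\<close>.
\<close>

lemma legendre_P_right:
  fixes c :: real and m :: nat
  assumes \<rho>: "norm \<rho> < 1" "\<rho> \<notin> \<real>\<^sub>\<le>\<^sub>0" and c: "c > 0"
  defines "B \<equiv> complex_of_real (c - 1 + real m)"
  assumes \<Psi>: "is_hyp2F1_continuation (B / 2) ((B + 1) / 2) (of_real c) \<Psi>"
  shows "legendre_P (- of_nat m) (- of_real (c - 1)) ((1 + \<rho>) / (1 - \<rho>)) =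
           \<rho> powr (of_real (c - 1) / 2) * (1 - \<rho>) ^ m * (1 + \<rho>) powr (- B) * \<Psi> (koebe \<rho>) / of_real (Gamma c)"
proof -
  define z where "z = (1 + \<rho>) / (1 - \<rho>)"
  have \<rho>1: "Re (1 + \<rho>) > 0" "1 + \<rho> \<noteq> 0" "\<rho> \<noteq> 0" "1 - \<rho> \<noteq> 0" "Re (1 - \<rho>) > 0"
    using Re_one_plus_pos[OF \<rho>(1)] \<rho> complex_Re_le_cmod[of \<rho>] by force+
  have z: "Re z > 0" "z \<noteq> 0" using Re_Cayley_pos[OF \<rho>(1)] by (auto simp: z_def)
  have z1: "(1 + z) / 2 = 1 / (1 - \<rho>)" "(z + 1) / (z - 1) = 1 / \<rho>"
    using \<rho>1 by (simp_all add: z_def field_simps)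
  have cc: "1 + complex_of_real (c - 1) = of_real c" "complex_of_real c \<notin> \<int>\<^sub>\<le>\<^sub>0"
    using of_real_notin_nonpos_Ints[OF c] by simp_all
  have "of_nat m \<in> (\<int>\<^sub>\<le>\<^sub>0 :: complex set) \<or> 1 - of_nat m \<in> (\<int>\<^sub>\<le>\<^sub>0 :: complex set)"
  proof (cases m)
    case (Suc k)
    then have "1 - of_nat m = (- of_nat k :: complex)" by simp
    then show ?thesis by (simp only: minus_of_nat_in_nonpos_Ints simp_thms)
  qed simp
  then have "is_hyp2F1_continuation (of_nat m) (1 - of_nat m) (of_real c)
          (hyp2F1 (of_nat m) (1 - of_nat m) (of_real c))"
    using c by (intro hyp2F1_is_continuation) auto
  then have "is_hyp2F1_continuation (- (of_nat m - 1)) (of_nat m - 1 + 1) (of_real c)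
          (hyp2F1 (of_nat m) (1 - of_nat m) (of_real c))"
    by (subst is_hyp2F1_continuation_commute) simp
  moreover have "of_nat m - 1 + complex_of_real (c - 1) + 1 = B" by (simp add: B_def)
  ultimately have hyp: "hyp2F1 (of_nat m) (1 - of_nat m) (of_real c) ((1 - z) / 2) =
      ((1 + z) / 2) powr of_real (c - 1) * z powr (- B) * \<Psi> (koebe \<rho>)"
    using quadratic_transformation[of "of_real (c - 1)" "of_nat m - 1", unfolded cc(1), OF cc(2) _ _ z(1)] \<Psi>
      koebe_eq[OF \<rho>(1)]
    by (simp only: z_def)
  have "Ln z = Ln (1 + \<rho>) - Ln (1 - \<rho>)" "Ln (1 / (1 - \<rho>)) = - Ln (1 - \<rho>)"
    using Ln_divide_Re_pos[OF \<rho>1(1) \<rho>1(5)] Ln_divide_Re_pos[of 1, OF _ \<rho>1(5)] by (simp_all add: z_def)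
  moreover have "Ln (1 / \<rho>) = - Ln \<rho>" using Ln_inverse[OF \<rho>(2)] by (simp add: divide_inverse)
  ultimately have logs: "- of_real (c - 1) / 2 * Ln (1 / \<rho>) + (of_real (c - 1) * Ln (1 / (1 - \<rho>)) + - B * Ln z) =
      of_real (c - 1) / 2 * Ln \<rho> + (of_nat m * Ln (1 - \<rho>) + - B * Ln (1 + \<rho>))"
    by (simp only:) (simp add: B_def field_simps)
  have "(1 / \<rho>) powr (- of_real (c - 1) / 2) * ((1 / (1 - \<rho>)) powr of_real (c - 1) * z powr (- B))
      = exp (- of_real (c - 1) / 2 * Ln (1 / \<rho>) + (of_real (c - 1) * Ln (1 / (1 - \<rho>)) + - B * Ln z))"
    unfolding exp_add using z \<rho>1 by (simp add: powr_def)
  also have "\<dots> = \<rho> powr (of_real (c - 1) / 2) * ((1 - \<rho>) ^ m * (1 + \<rho>) powr (- B))"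
    unfolding logs exp_add using \<rho>1 by (simp add: powr_def exp_of_nat_mult)
  finally have powers: "(1 / \<rho>) powr (- of_real (c - 1) / 2) * ((1 / (1 - \<rho>)) powr of_real (c - 1) * z powr (- B))
      = \<rho> powr (of_real (c - 1) / 2) * ((1 - \<rho>) ^ m * (1 + \<rho>) powr (- B))" .
  have Gam: "Gamma (complex_of_real c) = of_real (Gamma c)" by (rule Gamma_complex_of_real)
  have "legendre_P (- of_nat m) (- of_real (c - 1)) z =
     (1 / \<rho>) powr (- of_real (c - 1) / 2) * ((1 / (1 - \<rho>)) powr of_real (c - 1) * z powr (- B))
        * \<Psi> (koebe \<rho>) / of_real (Gamma c)"
  proof -
    have "- of_nat m + 1 = (1 - of_nat m :: complex)" "- (- of_nat m) = (of_nat m :: complex)" by simp_all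
    then show ?thesis
      unfolding legendre_P_def diff_minus_eq_add cc Gam[symmetric] by (simp only: hyp z1 mult_ac times_divide_eq_right times_divide_eq_left mult_1)
  qed
  from this[unfolded powers] show ?thesis unfolding z_def by (simp only: mult.assoc)
qed

theorem mainTheorem16:
  fixes m n :: nat and \<alpha> \<beta> :: real and \<rho> :: complex
    and R \<zeta> :: "real \<Rightarrow> complex"
  assumes "\<alpha> > -1" and "\<beta> > -1"
    and "\<alpha> \<in> {-1<..<0} \<and> \<beta> \<in> {-1<..<0} \<longrightarrow> \<alpha> + \<beta> + 1 \<noteq> 0"
    and "0 < norm \<rho>" and "norm \<rho> < 1" and "\<rho> \<notin> of_real ` {-1<..0::real}"
  defines "R \<equiv> \<lambda>x. csqrt (1 + \<rho>\<^sup>2 - 2 * \<rho> * of_real x)"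
    and "\<zeta> \<equiv> \<lambda>x. (1 + \<rho>) / R x"
  shows "((\<lambda>x. of_real ((1 - x) powr \<alpha> * (1 + x) powr (\<beta> / 2))
              / R x powr (of_real \<alpha> + of_nat m + 1)
              * legendre_P (of_real \<alpha> + of_nat m) (- of_real \<beta>) (\<zeta> x)
              * jacobi_P n (of_real \<alpha>) (of_real \<beta>) (of_real x))
          has_integral
            of_real (2 powr (\<alpha> + \<beta> / 2 + 1) * Gamma (\<alpha> + real n + 1)
                     * pochhammer (\<alpha> + \<beta> + real m + 1) (2 * n))
            / (fact n * \<rho> powr ((of_real \<alpha> + 1) / 2) * (1 - \<rho>) ^ m)
            * legendre_P (- of_nat m) (- of_real \<alpha> - of_real \<beta> - 2 * of_nat n - 1)
                ((1 + \<rho>) / (1 - \<rho>)))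
         {-1..1}"
proof -
  have \<rho>: "norm \<rho> < 1" "\<rho> \<notin> \<real>\<^sub>\<le>\<^sub>0"
  proof -
    show "norm \<rho> < 1" by fact
    show "\<rho> \<notin> \<real>\<^sub>\<le>\<^sub>0"
    proof
      assume "\<rho> \<in> \<real>\<^sub>\<le>\<^sub>0"
      then obtain y where "y \<le> 0" "\<rho> = of_real y" by (rule nonpos_Reals_cases)
      with \<open>norm \<rho> < 1\<close> \<open>\<rho> \<notin> of_real ` {-1<..0::real}\<close> show False by auto
    qed
  qed
  have \<rho>1: "1 + \<rho> \<noteq> 0" "\<rho> \<noteq> 0" "1 - \<rho> \<noteq> 0"
    using Re_one_plus_pos[OF \<rho>(1)] \<rho> by force+
  define \<gamma> where "\<gamma> = \<alpha> + real m"
  define A where "A = complex_of_real \<gamma> + of_real \<beta> + 1"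
  define c where "c = \<alpha> + \<beta> + 2 * real n + 2"
  define B where "B = complex_of_real (c - 1 + real m)"
  define \<Phi> where "\<Phi> = hyp2F1 (A / 2) ((A + 1) / 2) (of_real (\<beta> + 1))"
  define \<Psi> where "\<Psi> = hyp2F1 (B / 2) ((B + 1) / 2) (of_real c)"
  define v where "v = koebe \<rho>"
  define w where "w = (\<lambda>t. of_real (t powr \<beta> * (1 - t) powr \<alpha>)
      * jacobi_P n (of_real \<alpha>) (of_real \<beta>) (of_real (2 * t - 1)) * \<Phi> (v * of_real t))"
  define K where "K = pochhammer (A / 2) n * pochhammer ((A + 1) / 2) n / (of_real (pochhammer (\<beta> + 1) n) * fact n)
             * of_real (Beta (\<beta> + 1 + real n) (\<alpha> + 1 + real n))"
  define C where "C = of_real (2 powr (\<alpha> + \<beta> / 2)) * \<rho> powr (of_real \<beta> / 2) * (1 + \<rho>) powr (- A)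
                        / of_real (Gamma (\<beta> + 1))"
  note \<alpha>\<beta> = \<open>\<alpha> > -1\<close> \<open>\<beta> > -1\<close>
  have pos: "\<gamma> > -1" "c > 0" "(\<gamma> + \<beta> + 2) / 2 > 0" "(c + real m) / 2 > 0" "\<beta> + 1 > 0" using \<alpha>\<beta> by (simp_all add: \<gamma>_def c_def)
  have A2: "(A + 1) / 2 = complex_of_real ((\<gamma> + \<beta> + 2) / 2)" by (simp add: A_def)
  have \<Phi>: "is_hyp2F1_continuation (A / 2) ((A + 1) / 2) (of_real (\<beta> + 1)) \<Phi>"
    unfolding \<Phi>_def 
    by (intro hyp2F1_is_continuation disjI2 conjI) (simp_all only: A2 Re_complex_of_real Reals_of_real pos)
  have B2: "(B + 1) / 2 = complex_of_real ((c + real m) / 2)" by (simp add: B_def)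
  have \<Psi>: "is_hyp2F1_continuation (B / 2) ((B + 1) / 2) (of_real c) \<Psi>"
    unfolding \<Psi>_def 
    by (intro hyp2F1_is_continuation disjI2 conjI) (simp_all only: B2 Re_complex_of_real Reals_of_real pos)
  have BA: "B = A + 2 * of_nat n" by (simp add: B_def A_def c_def \<gamma>_def)
  have \<Psi>': "is_hyp2F1_continuation (A / 2 + of_nat n) ((A + 1) / 2 + of_nat n) (of_real (\<alpha> + \<beta> + 2 * real n + 2)) \<Psi>"
  proof -
    have "B / 2 = A / 2 + of_nat n" "(B + 1) / 2 = (A + 1) / 2 + of_nat n"
      by (simp_all add: BA field_simps)
    then show ?thesis using \<Psi> by (simp only: c_def)
  qed
  have "v \<in> hyp2F1_domain"
    unfolding v_def by (rule koebe_in_hyp2F1_domain[OF \<rho>(1)])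
  from jacobi_transform[OF \<alpha>\<beta> \<Phi> \<Psi>' this]
  have "(w has_integral K * v ^ n * \<Psi> v) (cbox 0 1)"
    by (simp add: w_def K_def)
  \<comment> \<open>The substitution \<open>t = (1 + x) / 2\<close>.\<close>
  from has_integral_affinity'[OF this, of "1/2" "1/2"]
  have "((\<lambda>x. w ((1 + x) / 2)) has_integral 2 * (K * v ^ n * \<Psi> v)) {-1..1}"
    by (simp add: scaleR_conv_of_real add_divide_distrib add.commute)
  then have int: "((\<lambda>x. C * w ((1 + x) / 2)) has_integral C * (2 * (K * v ^ n * \<Psi> v))) {-1..1}"
    by (rule has_integral_mult_right)
  have integrand: "of_real ((1 - x) powr \<alpha> * (1 + x) powr (\<beta> / 2))
              / R x powr (of_real \<alpha> + of_nat m + 1)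
              * legendre_P (of_real \<alpha> + of_nat m) (- of_real \<beta>) (\<zeta> x)
              * jacobi_P n (of_real \<alpha>) (of_real \<beta>) (of_real x) = C * w ((1 + x) / 2)"
    if x: "x \<in> {-1..1} - {-1, 1}" for x
  proof -
    define t where "t = (1 + x) / 2"
    have t: "0 < t" "t < 1" and xt: "x = 2 * t - 1" "1 + x = 2 * t" "1 - x = 2 * (1 - t)"
      using x by (auto simp: t_def field_simps)
    have "R x = (1 + \<rho>) * csqrt (1 - koebe \<rho> * of_real t)"
      unfolding R_def xt(1) using t by (intro csqrt_generating_radicand[OF \<rho>(1)]) auto
    then have R: "R x = (1 + \<rho>) / legendre_arg \<rho> t" by (simp add: legendre_arg_def)
    then have \<zeta>: "\<zeta> x = legendre_arg \<rho> t" using \<rho>1 by (simp add: \<zeta>_def)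
    have powers: "(1 - x) powr \<alpha> * (1 + x) powr (\<beta> / 2) * t powr (\<beta> / 2)
        = 2 powr (\<alpha> + \<beta> / 2) * (t powr \<beta> * (1 - t) powr \<alpha>)"
    proof -
      have "t powr \<beta> = t powr (\<beta> / 2) * t powr (\<beta> / 2)" by (simp flip: powr_add)
      moreover have "(2 * (1 - t)) powr \<alpha> = 2 powr \<alpha> * (1 - t) powr \<alpha>"
        "(2 * t) powr (\<beta> / 2) = 2 powr (\<beta> / 2) * t powr (\<beta> / 2)"
        by (simp_all only: powr_mult)
      ultimately show ?thesis unfolding xt(2,3) by (simp only: powr_add mult_ac)
    qed
    have \<gamma>: "of_real \<alpha> + of_nat m = complex_of_real \<gamma>" by (simp add: \<gamma>_def)
    define J where "J = jacobi_P n (of_real \<alpha>) (of_real \<beta>) (of_real x)"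
    have "of_real ((1 - x) powr \<alpha> * (1 + x) powr (\<beta> / 2)) / R x powr (of_real \<gamma> + 1)
              * legendre_P (of_real \<gamma>) (- of_real \<beta>) (\<zeta> x) * J =
          of_real ((1 - x) powr \<alpha> * (1 + x) powr (\<beta> / 2)) *
            (legendre_P (of_real \<gamma>) (- of_real \<beta>) (legendre_arg \<rho> t) / ((1 + \<rho>) / legendre_arg \<rho> t) powr (of_real \<gamma> + 1)) * J"
      unfolding R \<zeta> by (simp only: divide_inverse mult_ac)
    also have "legendre_P (of_real \<gamma>) (- of_real \<beta>) (legendre_arg \<rho> t) / ((1 + \<rho>) / legendre_arg \<rho> t) powr (of_real \<gamma> + 1) =
        \<rho> powr (of_real \<beta> / 2) * of_real (t powr (\<beta> / 2)) * (1 + \<rho>) powr (- A)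
             * \<Phi> (koebe \<rho> * of_real t) / of_real (Gamma (\<beta> + 1))"
      unfolding A_def by (rule legendre_P_left[OF \<rho> t pos(1) \<alpha>\<beta>(2) \<Phi>[unfolded A_def]])
    also have "of_real ((1 - x) powr \<alpha> * (1 + x) powr (\<beta> / 2)) * (\<rho> powr (of_real \<beta> / 2) * of_real (t powr (\<beta> / 2)) * (1 + \<rho>) powr (- A)
             * \<Phi> (koebe \<rho> * of_real t) / of_real (Gamma (\<beta> + 1))) * J =
        of_real ((1 - x) powr \<alpha> * (1 + x) powr (\<beta> / 2) * t powr (\<beta> / 2)) * (\<rho> powr (of_real \<beta> / 2) * (1 + \<rho>) powr (- A)
             * \<Phi> (koebe \<rho> * of_real t) / of_real (Gamma (\<beta> + 1)) * J)"
      by (simp only: of_real_mult divide_inverse mult_ac)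
    also have "\<dots> = C * w t"
      unfolding powers unfolding C_def w_def J_def v_def xt(1)
      by (simp only: of_real_mult divide_inverse mult_ac)
    finally show ?thesis unfolding J_def t_def \<gamma> .
  qed
  have closed_form: "C * (2 * (K * v ^ n * \<Psi> v)) = of_real (2 powr (\<alpha> + \<beta> / 2 + 1) * Gamma (\<alpha> + real n + 1)
                     * pochhammer (\<alpha> + \<beta> + real m + 1) (2 * n))
            / (fact n * \<rho> powr ((of_real \<alpha> + 1) / 2) * (1 - \<rho>) ^ m)
            * legendre_P (- of_nat m) (- of_real \<alpha> - of_real \<beta> - 2 * of_nat n - 1)
                ((1 + \<rho>) / (1 - \<rho>))"
  proof -
    have order: "- of_real \<alpha> - of_real \<beta> - 2 * of_nat n - 1 = - complex_of_real (c - 1)"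
      by (simp add: c_def)
    have Gpos: "Gamma (\<beta> + 1) > 0" "Gamma (\<beta> + 1 + real n) > 0" "Gamma c > 0" "pochhammer (\<beta> + 1) n > 0"
      using \<alpha>\<beta> pos by (auto intro!: Gamma_real_pos pochhammer_pos)
    have int: "\<beta> + 1 \<notin> \<int>\<^sub>\<le>\<^sub>0" using \<alpha>\<beta> by (auto elim!: nonpos_Ints_cases)
    have poch\<beta>: "pochhammer (\<beta> + 1) n * Gamma (\<beta> + 1) = Gamma (\<beta> + 1 + real n)"
      unfolding pochhammer_Gamma[OF int] using Gpos(1) by simp
    have "Beta (\<beta> + 1 + real n) (\<alpha> + 1 + real n) / (pochhammer (\<beta> + 1) n * Gamma (\<beta> + 1)) =
            Gamma (\<alpha> + real n + 1) / Gamma c"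
    proof -
      have args: "\<beta> + 1 + real n + (\<alpha> + 1 + real n) = c" "\<alpha> + 1 + real n = \<alpha> + real n + 1"
        by (simp_all add: c_def)
      show ?thesis unfolding poch\<beta> Beta_def args(1) unfolding args(2) using Gpos(2) by simp
    qed
    from arg_cong[OF this, of complex_of_real]
    have beta: "complex_of_real (Beta (\<beta> + 1 + real n) (\<alpha> + 1 + real n)) /
          (of_real (pochhammer (\<beta> + 1) n) * of_real (Gamma (\<beta> + 1))) =
            of_real (Gamma (\<alpha> + real n + 1)) / of_real (Gamma c)"
      by (simp only: of_real_mult of_real_divide)
    have pochA: "complex_of_real (pochhammer (\<alpha> + \<beta> + real m + 1) (2 * n)) =
        4 ^ n * (pochhammer (A / 2) n * pochhammer ((A + 1) / 2) n)"
    proof -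
      have "complex_of_real (pochhammer (\<alpha> + \<beta> + real m + 1) (2 * n)) = pochhammer A (2 * n)"
        unfolding pochhammer_of_real[symmetric] by (simp add: A_def \<gamma>_def add_ac)
      also have "\<dots> = pochhammer (2 * (A / 2)) (2 * n)" by simp
      also have "\<dots> = of_nat (2 ^ (2 * n)) * pochhammer (A / 2) n * pochhammer (A / 2 + 1 / 2) n"
        by (rule pochhammer_double)
      also have "A / 2 + 1 / 2 = (A + 1) / 2" by (rule add_divide_distrib[symmetric])
      also have "of_nat (2 ^ (2 * n)) = (4 ^ n :: complex)" by (simp add: power_mult)
      finally show ?thesis by (simp only: mult.assoc)
    qed
    have vn: "v ^ n * (1 + \<rho>) powr (- A) = 4 ^ n * \<rho> ^ n * (1 + \<rho>) powr (- B)"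
    proof -
      have "(1 + \<rho>) powr (- A) = (1 + \<rho>) powr (- B + of_nat (2 * n))" by (simp add: BA)
      also have "\<dots> = (1 + \<rho>) powr (- B) * ((1 + \<rho>)\<^sup>2) ^ n"
        by (simp only: powr_add powr_complexpow[OF \<rho>1(1)] power_mult)
      finally have "v ^ n * (1 + \<rho>) powr (- A) = v ^ n * ((1 + \<rho>)\<^sup>2) ^ n * (1 + \<rho>) powr (- B)"
        by (simp only: mult_ac)
      also have "v ^ n * ((1 + \<rho>)\<^sup>2) ^ n = (v * (1 + \<rho>)\<^sup>2) ^ n" by (rule power_mult_distrib[symmetric])
      also have "v * (1 + \<rho>)\<^sup>2 = 4 * \<rho>" using \<rho>1 by (simp add: v_def koebe_def)
      finally show ?thesis by (simp only: power_mult_distrib)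
    qed
    have "of_real (c - 1) / 2 = (of_real \<alpha> + 1) / 2 + (of_real \<beta> / 2 + complex_of_nat n)"
      by (simp add: c_def field_simps)
    then have "\<rho> powr (of_real (c - 1) / 2) = \<rho> powr ((of_real \<alpha> + 1) / 2) * (\<rho> powr (of_real \<beta> / 2) * \<rho> ^ n)"
      by (simp only: powr_add powr_complexpow[OF \<rho>1(2)])
    moreover have "\<rho> powr ((of_real \<alpha> + 1) / 2) \<noteq> 0"
      using \<rho>1(2) by simp
    ultimately have rhopow: "\<rho> powr (of_real (c - 1) / 2) / \<rho> powr ((of_real \<alpha> + 1) / 2) =
        \<rho> powr (of_real \<beta> / 2) * \<rho> ^ n"
      by (metis nonzero_mult_div_cancel_left)
    have "2 powr (\<alpha> + \<beta> / 2 + 1) = 2 * 2 powr (\<alpha> + \<beta> / 2)"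
      using powr_add[of 2 "\<alpha> + \<beta> / 2" 1] by simp
    then have two: "complex_of_real (2 powr (\<alpha> + \<beta> / 2 + 1)) = 2 * of_real (2 powr (\<alpha> + \<beta> / 2))"
      by (simp only: of_real_mult of_real_numeral)
    have regroup: "a * b * e / g * (2 * (p / (h * f) * B' * x * y)) = 2 * a * p / f * b * (x * e) * (B' / (h * g)) * y"
      for a b e g p h f B' x y :: complex
      by (simp only: divide_inverse inverse_mult_distrib mult_ac)
    have cancel: "2 * a * p / f * (s / r) * b * (g' / g) * y = 2 * a * g' * p / (f * r * q) * (s * q * b * y / g)"
      if "q \<noteq> 0" for a p f s r b g g' y q :: complex
    proof -
      have "2 * a * g' * p / (f * r * q) * (s * q * b * y / g) =
              (q * inverse q) * (2 * a * p / f * (s / r) * b * (g' / g) * y)"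
        by (simp only: divide_inverse inverse_mult_distrib mult_ac)
      then show ?thesis by (simp only: right_inverse[OF that] mult_1)
    qed
    define P where "P = pochhammer (A / 2) n * pochhammer ((A + 1) / 2) n"
    have "C * (2 * (K * v ^ n * \<Psi> v)) =
        2 * of_real (2 powr (\<alpha> + \<beta> / 2)) * P / fact n * \<rho> powr (of_real \<beta> / 2) *
        (v ^ n * (1 + \<rho>) powr (- A)) * (complex_of_real (Beta (\<beta> + 1 + real n) (\<alpha> + 1 + real n)) /
          (of_real (pochhammer (\<beta> + 1) n) * of_real (Gamma (\<beta> + 1)))) * \<Psi> v"
      unfolding C_def K_def P_def by (rule regroup)
    also have "\<dots> = 2 * of_real (2 powr (\<alpha> + \<beta> / 2)) * (4 ^ n * P) / fact n * (\<rho> powr (of_real \<beta> / 2) * \<rho> ^ n) *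
        (1 + \<rho>) powr (- B) * (of_real (Gamma (\<alpha> + real n + 1)) / of_real (Gamma c)) * \<Psi> v"
      unfolding vn beta by (simp only: divide_inverse mult_ac)
    also have "\<dots> = of_real (2 powr (\<alpha> + \<beta> / 2 + 1) * Gamma (\<alpha> + real n + 1)
                     * pochhammer (\<alpha> + \<beta> + real m + 1) (2 * n))
            / (fact n * \<rho> powr ((of_real \<alpha> + 1) / 2) * (1 - \<rho>) ^ m)
            * (\<rho> powr (of_real (c - 1) / 2) * (1 - \<rho>) ^ m * (1 + \<rho>) powr (- B) * \<Psi> v / of_real (Gamma c))"
      unfolding of_real_mult two pochA P_def[symmetric] rhopow[symmetric] by (rule cancel) (use \<rho>1 in simp)
    also have "\<rho> powr (of_real (c - 1) / 2) * (1 - \<rho>) ^ m * (1 + \<rho>) powr (- B) * \<Psi> v / of_real (Gamma c) =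
        legendre_P (- of_nat m) (- of_real (c - 1)) ((1 + \<rho>) / (1 - \<rho>))"
      unfolding v_def B_def by (rule legendre_P_right[OF \<rho> pos(2) \<Psi>[unfolded B_def], symmetric])
    finally show ?thesis unfolding order .
  qed
  \<comment> \<open>At the endpoints the integrand takes the default values of \<open>powr\<close> and division; they do not affect the integral.\<close>
  have "finite {-1, 1 :: real}" by simp
  from has_integral_spike_finite[OF this integrand int]
  show ?thesis unfolding closed_form[symmetric] by simp
qed

end
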